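(* Let $\Omega\subset\mathbb{R}^2$ be a bounded domain with $C^2$-boundary and let $p_0>1$. Then there exists a constant $C$, depending only on $p_0$ and $\Omega$, such that for every real $p\geq p_0$ and every function $u_p\in C^2(\Omega)\cap C^0(\overline{\Omega})$ satisfying $$\Delta u_p+u_p^p=0 \ \text{ in } \Omega,\qquad u_p>0 \ \text{ in } \Omega,\qquad u_p=0 \ \text{ on } \partial\Omega,$$ one has $$\|u_p\|_{L^\infty(\Omega)}\leq C.$$
   Context: A domain is a nonempty connected open set. $\Delta$ is the Laplacian on $\mathbb{R}^2$; in $u_p^p$ the superscript is the power $p$, while the subscript in $u_p$ only records that the solution corresponds to the exponent $p$. *)

theory Defs
  imports "HOL-Analysis.Analysis" "HOL-Probability.Essential_Supremum"
begin

definition is_domain :: "'a::topological_space set \<Rightarrow> bool" where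
  "is_domain S \<longleftrightarrow> S \<noteq> {} \<and> connected S \<and> open S"

text \<open>Twice continuously differentiable on \<open>S\<close>, which is meant to be open: the first and
  second derivatives are taken in the Frechet sense, with values in normed spaces of bounded
  linear maps.\<close>

definition C2_on :: "'a::real_normed_vector set \<Rightarrow> ('a \<Rightarrow> 'b::real_normed_vector) \<Rightarrow> bool" where
  "C2_on S f \<longleftrightarrow>
     (\<exists>(f' :: 'a \<Rightarrow> 'a \<Rightarrow>\<^sub>L 'b) (f'' :: 'a \<Rightarrow> 'a \<Rightarrow>\<^sub>L ('a \<Rightarrow>\<^sub>L 'b)).
        (\<forall>x\<in>S. (f has_derivative blinfun_apply (f' x)) (at x)) \<and>
        (\<forall>x\<in>S. (f' has_derivative blinfun_apply (f'' x)) (at x)) \<and>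
        continuous_on S f'')"

definition partial_deriv :: "'n \<Rightarrow> (real ^ 'n \<Rightarrow> real) \<Rightarrow> real ^ 'n \<Rightarrow> real" where
  "partial_deriv i f x = deriv (\<lambda>t. f (x + t *\<^sub>R axis i 1)) 0"

definition laplacian :: "(real ^ 'n \<Rightarrow> real) \<Rightarrow> real ^ 'n \<Rightarrow> real" where
  "laplacian f x = (\<Sum>i\<in>UNIV. partial_deriv i (partial_deriv i f) x)"

text \<open>Near each boundary point the set is, in suitable orthonormal coordinates \<open>T x\<close>, the
  region strictly above the graph of a \<open>C\<^sup>2\<close> function; in particular it lies locally on one
  side of its boundary.\<close>

definition C2_boundary :: "(real ^ 2) set \<Rightarrow> bool" where
  "C2_boundary S \<longleftrightarrow>
     (\<forall>x0\<in>frontier S. \<exists>r>0. \<exists>(T :: real ^ 2 \<Rightarrow> real ^ 2) (\<gamma> :: real \<Rightarrow> real).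
        orthogonal_transformation T \<and> C2_on UNIV \<gamma> \<and>
        S \<inter> ball x0 r = {x \<in> ball x0 r. \<gamma> (T x $ 1) < T x $ 2})"

definition Linf_norm :: "'a::euclidean_space set \<Rightarrow> ('a \<Rightarrow> real) \<Rightarrow> ereal" where
  "Linf_norm S f = esssup (lebesgue_on S) (\<lambda>x. ereal \<bar>f x\<bar>)"

end

theory Submission
  imports Defs
begin

text \<open>
  Write \<open>u\<close> around a point \<open>c\<close> in logarithmic polar coordinates \<open>(s, t)\<close>, \<open>x = c + exp s (cos t, sin t)\<close>;
  as the change of variables is conformal, the equation becomes \<open>U\<^sub>s\<^sub>s + U\<^sub>t\<^sub>t = - exp (2 s) U powr p\<close>.

  Near a boundary point, choose \<open>c\<close> outside the domain as the centre of a small exterior tangent circle.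
  Inversions in circles around \<open>c\<close> are reflections in lines \<open>s = const\<close>, and the weight \<open>exp (2 s)\<close>
  increases with \<open>s\<close>, so the moving plane method applies and shows that \<open>u\<close> has no maximum point near the
  boundary point. By compactness, every maximum point is at a distance \<open>\<ge> d\<close> from the boundary, with \<open>d\<close>
  depending only on the domain.

  At a maximum point \<open>c\<close> with value \<open>M\<close>, let \<open>m s\<close> be the mean of \<open>u\<close> over the circle of radius \<open>exp s\<close>, so that
  \<open>m'' = - exp (2 s)\<close> times the mean of \<open>u powr p\<close>. At radius of order \<open>(p M powr (p - 1)) powr (-1/2)\<close>, Bernoulli's
  inequality keeps the mean of \<open>u powr p\<close> above \<open>M powr p / 2\<close>, so the slope of \<open>m\<close> is at most \<open>- const M / p\<close> from
  there on. Since \<open>m\<close> stays positive, \<open>ln d\<close> exceeds the logarithm of that radius by at most \<open>O(p)\<close>, that is,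
  \<open>M powr (p - 1) \<le> exp (O(p)) / d\<^sup>2\<close>.
\<close>

section \<open>One-variable calculus\<close>

lemma second_deriv_local_min:
  fixes f g :: "real \<Rightarrow> real"
  assumes f: "\<forall>\<^sub>F t in nhds x. (f has_real_derivative g t) (at t)"
    and g: "(g has_real_derivative D) (at x)"
    and min: "\<forall>\<^sub>F t in nhds x. f x \<le> f t"
  shows "D \<ge> 0"
proof (rule ccontr)
  assume "\<not> D \<ge> 0"
  then have D: "D < 0" by simp
  obtain e1 where e1: "e1 > 0" "\<And>t. dist t x < e1 \<Longrightarrow> (f has_real_derivative g t) (at t)"
    using f unfolding eventually_nhds_metric by blast
  obtain e2 where e2: "e2 > 0" "\<And>t. dist t x < e2 \<Longrightarrow> f x \<le> f t"
    using min unfolding eventually_nhds_metric by blast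
  have "g x = 0"
    by (rule DERIV_local_min[OF e1(2) e2(1)]) (use e1 e2 in \<open>auto simp: dist_real_def abs_minus_commute\<close>)
  moreover obtain e3 where e3: "e3 > 0" "\<And>h. 0 < h \<Longrightarrow> h < e3 \<Longrightarrow> g (x + h) < g x"
    using DERIV_neg_dec_right[OF g D] by blast
  ultimately have neg: "g (x + h) < 0" if "0 < h" "h < e3" for h
    using that by metis
  define h where "h = min e1 (min e2 e3) / 2"
  have h: "0 < h" "h < e1" "h < e2" "h < e3"
    using e1 e2 e3 by (auto simp: h_def)
  have "\<exists>z. x < z \<and> z < x + h \<and> f (x + h) - f x = (x + h - x) * g z"
    by (rule MVT2) (use h e1 in \<open>auto simp: dist_real_def\<close>)
  then obtain z where z: "x < z" "z < x + h" "f (x + h) - f x = h * g z" by auto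
  have "g z < 0" using neg[of "z - x"] z h by simp
  then have "f (x + h) < f x" using z h mult_pos_neg[of h "g z"] by linarith
  moreover have "f x \<le> f (x + h)" using e2(2)[of "x + h"] h by (simp add: dist_real_def)
  ultimately show False by simp
qed

text \<open>This is the mean value theorem. It serves as the Lipschitz bound for the nonlinearity in
  \<open>W_laplacian_le\<close> and, with \<open>t = M\<close>, as Bernoulli's inequality in
  \<open>max_bound\<close>.\<close>

lemma powr_diff_le:
  fixes s t M p :: real
  assumes "0 < s" "s \<le> t" "t \<le> M" "1 \<le> p"
  shows "t powr p - s powr p \<le> p * M powr (p - 1) * (t - s)"
proof (cases "s = t")
  case False
  then have st: "s < t" using assms by simp
  have "\<exists>z. s < z \<and> z < t \<and> t powr p - s powr p = (t - s) * (p * z powr (p - 1))"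
    by (rule MVT2) (use assms st in \<open>auto intro!: derivative_eq_intros simp: field_simps powr_diff\<close>)
  then obtain z where z: "s < z" "z < t" "t powr p - s powr p = (t - s) * (p * z powr (p - 1))"
    by auto
  have "z powr (p - 1) \<le> M powr (p - 1)"
    using z assms by (intro powr_mono2) auto
  then have "(t - s) * (p * z powr (p - 1)) \<le> (t - s) * (p * M powr (p - 1))"
    using st assms by (intro mult_left_mono) auto
  then show ?thesis using z by (simp add: mult_ac)
qed simp

text \<open>A convex function lies above its tangents. A tangent of negative slope would force it to
  infinity at the left end, contrary to the finite limit; so it is nondecreasing and stays above
  that limit. In logarithmic polar coordinates the left end is the centre of the circles.\<close>

lemma convex_bounded_at_bot:
  fixes f f' f'' :: "real \<Rightarrow> real"
  assumes f: "\<And>x. x < b \<Longrightarrow> (f has_real_derivative f' x) (at x)"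
    and f': "\<And>x. x < b \<Longrightarrow> (f' has_real_derivative f'' x) (at x)"
    and pos: "\<And>x. x < b \<Longrightarrow> f'' x \<ge> 0"
    and lim: "(f \<longlongrightarrow> L) at_bot"
    and x: "x < b"
  shows "f' x \<ge> 0" and "f x \<ge> L"
proof -
  have mono': "f' y \<le> f' z" if "y \<le> z" "z < b" for y z
    by (rule DERIV_nonneg_imp_nondecreasing[OF that(1)]) (use f' pos that in \<open>meson order_le_less_trans\<close>)
  have nn: "f' z \<ge> 0" if z: "z < b" for z
  proof (rule ccontr)
    assume "\<not> f' z \<ge> 0"
    then have neg: "f' z < 0" by simp
    have below: "f y \<ge> f z + f' z * (y - z)" if "y < z" for y
    proof -
      have "\<exists>w. y < w \<and> w < z \<and> f z - f y = (z - y) * f' w"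
        by (rule MVT2) (use that z f in auto)
      then obtain w where w: "y < w" "w < z" "f z - f y = (z - y) * f' w" by auto
      have "(z - y) * f' w \<le> (z - y) * f' z"
        using mono'[of w z] w z by (intro mult_left_mono) auto
      then show ?thesis using w by (simp add: algebra_simps)
    qed
    have "\<forall>\<^sub>F y in at_bot. f y < L + 1"
      using lim by (rule order_tendstoD) simp
    \<comment> \<open>To the left of the second threshold the tangent at \<open>z\<close>, whose
      slope is negative, is higher than \<open>L + 1\<close>.\<close>
    moreover have "\<forall>\<^sub>F y in at_bot. y < z \<and> y < z + (L + 1 - f z) / f' z"
      by (intro eventually_conj eventually_gt_at_bot)
    ultimately have "\<forall>\<^sub>F y in at_bot. f y < L + 1 \<and> y < z \<and> y < z + (L + 1 - f z) / f' z"
      by (rule eventually_conj)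
    then obtain y where y: "f y < L + 1" "y < z" "y < z + (L + 1 - f z) / f' z"
      using eventually_happens[of _ at_bot] trivial_limit_at_bot_linorder by blast
    have "y - z < (L + 1 - f z) / f' z" using y by linarith
    then have "f' z * (y - z) > L + 1 - f z" using neg by (simp add: field_simps)
    then show False using below[of y] y by linarith
  qed
  show "f' x \<ge> 0" using nn x by blast
  have "f y \<le> f x" if "y < x" for y
    by (rule DERIV_nonneg_imp_nondecreasing) (use that x f nn in \<open>meson order_le_less_trans less_imp_le\<close>)+
  then have "\<forall>\<^sub>F y in at_bot. f y \<le> f x"
    using eventually_mono[OF eventually_gt_at_bot[of x], of "\<lambda>y. f y \<le> f x"] by blast
  then show "f x \<ge> L"
    using lim by (intro tendsto_upperbound[of f L at_bot]) auto
qed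

section \<open>Minimum principles in the plane\<close>

lemma laplacian_local_min:
  fixes f f1 f2 :: "real \<times> real \<Rightarrow> real"
  assumes A: "open A" "(x, y) \<in> A"
    and f1: "\<And>s t. (s, t) \<in> A \<Longrightarrow> ((\<lambda>s. f (s, t)) has_real_derivative f1 (s, t)) (at s)"
    and f2: "\<And>s t. (s, t) \<in> A \<Longrightarrow> ((\<lambda>t. f (s, t)) has_real_derivative f2 (s, t)) (at t)"
    and D1: "((\<lambda>s. f1 (s, y)) has_real_derivative D1) (at x)"
    and D2: "((\<lambda>t. f2 (x, t)) has_real_derivative D2) (at y)"
    and min: "\<forall>\<^sub>F z in nhds (x, y). f (x, y) \<le> f z"
  shows "D1 + D2 \<ge> 0"
proof -
  have l1: "((\<lambda>s. (s, y)) \<longlongrightarrow> (x, y)) (nhds x)" and l2: "((\<lambda>t. (x, t)) \<longlongrightarrow> (x, y)) (nhds y)"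
    by (auto intro: tendsto_Pair filterlim_ident tendsto_const)
  have A': "\<forall>\<^sub>F z in nhds (x, y). z \<in> A"
    using A by (rule eventually_nhds_in_open)
  have "D1 \<ge> 0"
  proof (rule second_deriv_local_min[OF _ D1])
    show "\<forall>\<^sub>F s in nhds x. ((\<lambda>s. f (s, y)) has_real_derivative f1 (s, y)) (at s)"
      using l1[unfolded filterlim_iff, rule_format, OF A'] by eventually_elim (rule f1)
    show "\<forall>\<^sub>F s in nhds x. f (x, y) \<le> f (s, y)"
      using l1[unfolded filterlim_iff, rule_format, OF min] .
  qed
  moreover have "D2 \<ge> 0"
  proof (rule second_deriv_local_min[OF _ D2])
    show "\<forall>\<^sub>F t in nhds y. ((\<lambda>t. f (x, t)) has_real_derivative f2 (x, t)) (at t)"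
      using l2[unfolded filterlim_iff, rule_format, OF A'] by eventually_elim (rule f2)
    show "\<forall>\<^sub>F t in nhds y. f (x, y) \<le> f (x, t)"
      using l2[unfolded filterlim_iff, rule_format, OF min] .
  qed
  ultimately show ?thesis by simp
qed

text \<open>\<open>Q\<close> stands for the squared distance to a centre as a function of one
  coordinate with the other frozen, so a single computation yields both partial derivatives of the
  barrier used below.\<close>

lemma inverse_quadratic_derivs:
  fixes Q :: "real \<Rightarrow> real"
  assumes Q: "\<And>x. (Q has_real_derivative 2 * (x - d)) (at x)" and nz: "Q x \<noteq> 0"
  shows "((\<lambda>x. 1 / Q x - e) has_real_derivative - 2 * (x - d) / (Q x)\<^sup>2) (at x)"
    and "((\<lambda>x. - 2 * (x - d) / (Q x)\<^sup>2) has_real_derivative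
           - 2 / (Q x)\<^sup>2 + 8 * (x - d)\<^sup>2 / (Q x) ^ 3) (at x)"
proof -
  have 1: "((\<lambda>x. 1 / Q x - e) has_real_derivative (0 * Q x - 1 * (2 * (x - d))) / (Q x * Q x) - 0) (at x)"
    by (rule derivative_intros Q nz)+
  then show "((\<lambda>x. 1 / Q x - e) has_real_derivative - 2 * (x - d) / (Q x)\<^sup>2) (at x)"
    by (simp add: power2_eq_square)
  have "((\<lambda>x. - 2 * (x - d)) has_real_derivative - 2) (at x)"
    by (auto intro!: derivative_eq_intros)
  moreover have "((\<lambda>x. (Q x)\<^sup>2) has_real_derivative 2 * Q x * (2 * (x - d))) (at x)"
    by (rule derivative_eq_intros Q)+ simp
  ultimately have D: "((\<lambda>x. - 2 * (x - d) / (Q x)\<^sup>2) has_real_derivative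
      (- 2 * (Q x)\<^sup>2 - (- 2 * (x - d)) * (2 * Q x * (2 * (x - d)))) / ((Q x)\<^sup>2 * (Q x)\<^sup>2)) (at x)"
    by (rule DERIV_divide) (use nz in simp)
  have I: "(- 2 * q\<^sup>2 - (- 2 * y) * (2 * q * (2 * y))) / (q\<^sup>2 * q\<^sup>2) = - 2 / q\<^sup>2 + 8 * y\<^sup>2 / q ^ 3"
    if "q \<noteq> 0" for q y :: real
  proof -
    have "- 2 / q\<^sup>2 = (- 2 * q\<^sup>2) / (q\<^sup>2 * q\<^sup>2)"
      by (rule nonzero_mult_divide_mult_cancel_right[symmetric]) (use that in simp)
    moreover have "8 * y\<^sup>2 / q ^ 3 = (8 * y\<^sup>2 * q) / (q ^ 3 * q)"
      by (rule nonzero_mult_divide_mult_cancel_right[symmetric]) (use that in simp)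
    moreover have "q ^ 3 * q = q\<^sup>2 * q\<^sup>2" by (simp add: power2_eq_square power3_eq_cube)
    moreover have "- 2 * q\<^sup>2 - (- 2 * y) * (2 * q * (2 * y)) = - 2 * q\<^sup>2 + 8 * y\<^sup>2 * q"
      by (simp add: power2_eq_square)
    ultimately show ?thesis by (metis add_divide_distrib)
  qed
  show "((\<lambda>x. - 2 * (x - d) / (Q x)\<^sup>2) has_real_derivative
           - 2 / (Q x)\<^sup>2 + 8 * (x - d)\<^sup>2 / (Q x) ^ 3) (at x)"
    using D unfolding I[OF nz] .
qed

text \<open>Comparison with \<open>1 / |z - c|\<^sup>2\<close>, which is strictly subharmonic in the plane.\<close>

lemma superharmonic_pos_on_ball:
  fixes f f1 f2 f11 f22 :: "real \<times> real \<Rightarrow> real"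
  assumes A: "open A" "cball c R \<subseteq> A"
    and f1: "\<And>s t. (s, t) \<in> A \<Longrightarrow> ((\<lambda>s. f (s, t)) has_real_derivative f1 (s, t)) (at s)"
    and f2: "\<And>s t. (s, t) \<in> A \<Longrightarrow> ((\<lambda>t. f (s, t)) has_real_derivative f2 (s, t)) (at t)"
    and f11: "\<And>s t. (s, t) \<in> A \<Longrightarrow> ((\<lambda>s. f1 (s, t)) has_real_derivative f11 (s, t)) (at s)"
    and f22: "\<And>s t. (s, t) \<in> A \<Longrightarrow> ((\<lambda>t. f2 (s, t)) has_real_derivative f22 (s, t)) (at t)"
    and cont: "continuous_on A f"
    and super: "\<And>z. z \<in> A \<Longrightarrow> f11 z + f22 z \<le> 0"
    and nonneg: "\<And>z. z \<in> A \<Longrightarrow> f z \<ge> 0"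
    and pos: "f c > 0"
    and z: "z \<in> ball c R"
  shows "f z > 0"
proof -
  have R: "R > 0" using z by (metis ball_eq_empty empty_iff not_less)
  have "c \<in> A" using A R by auto
  then have "isCont f c" using A cont by (simp add: continuous_on_eq_continuous_at)
  then have "(f \<longlongrightarrow> f c) (nhds c)" by (simp add: isCont_def tendsto_at_iff_tendsto_nhds)
  then have "\<forall>\<^sub>F w in nhds c. f w > f c / 2"
    by (rule order_tendstoD(1)) (use pos in simp)
  then obtain s0 where s0: "s0 > 0" "\<And>w. dist w c < s0 \<Longrightarrow> f w > f c / 2"
    unfolding eventually_nhds_metric by blast
  define s where "s = min s0 R / 2"
  have s: "0 < s" "s < s0" "s < R" using s0 R by (auto simp: s_def)
  show ?thesis
  proof (cases "dist z c < s0")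
    case True
    then show ?thesis using s0(2)[of z] pos by linarith
  next
    case far: False
    obtain c1 c2 where c: "c = (c1, c2)" by (cases c)
    define q where "q z = (fst z - c1)\<^sup>2 + (snd z - c2)\<^sup>2" for z :: "real \<times> real"
    have q: "q w = (dist w c)\<^sup>2" for w
      by (cases w) (simp add: q_def c dist_Pair_Pair dist_real_def)
    \<comment> \<open>Chosen so that \<open>e / s\<^sup>2 = f c / 2\<close>: the barrier
      \<open>e * h\<close> is then below \<open>f\<close> on the inner circle, while
      \<open>h\<close> vanishes on the outer one.\<close>
    define e where "e = f c / 2 * s\<^sup>2"
    have e: "e > 0" using pos s by (simp add: e_def)
    define h where "h z = 1 / q z - 1 / R\<^sup>2" for z
    define h1 where "h1 z = - 2 * (fst z - c1) / (q z)\<^sup>2" for z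
    define h2 where "h2 z = - 2 * (snd z - c2) / (q z)\<^sup>2" for z
    define h11 where "h11 z = - 2 / (q z)\<^sup>2 + 8 * (fst z - c1)\<^sup>2 / (q z) ^ 3" for z
    define h22 where "h22 z = - 2 / (q z)\<^sup>2 + 8 * (snd z - c2)\<^sup>2 / (q z) ^ 3" for z
    define K where "K = cball c R - ball c s"
    have compK: "compact K" unfolding K_def by (intro compact_diff) auto
    have q0: "q w \<noteq> 0" if "w \<noteq> c" for w using that by (simp add: q)
    have qK: "q w \<noteq> 0" if "w \<in> K" for w
      using that s q0[of w] by (cases "w = c") (auto simp: K_def)
    have contF: "continuous_on K (\<lambda>w. f w - e * h w)"
    proof -
      have "continuous_on K f" using cont A by (auto simp: K_def intro: continuous_on_subset)
      moreover have "continuous_on K q" unfolding q_def by (intro continuous_intros)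
      then have "continuous_on K h"
        unfolding h_def by (intro continuous_intros) (use qK R in auto)
      ultimately show ?thesis by (intro continuous_intros)
    qed
    have zK: "z \<in> K" using z far s by (auto simp: K_def dist_commute)
    obtain w where w: "w \<in> K" "\<And>v. v \<in> K \<Longrightarrow> f w - e * h w \<le> f v - e * h v"
      using continuous_attains_inf[OF compK _ contF] zK by blast
    \<comment> \<open>A negative minimum over the annulus can lie on neither bounding circle. At an
      interior minimum the Laplacian of \<open>f - e * h\<close> would be nonnegative, but it is
      negative because that of \<open>h\<close> is \<open>4 / q\<^sup>2\<close>.\<close>
    have "f w - e * h w \<ge> 0"
    proof (rule ccontr)
      assume neg: "\<not> ?thesis"
      have dw: "s \<le> dist w c" "dist w c \<le> R" using w by (auto simp: K_def dist_commute)
      have wA: "w \<in> A" using w A by (auto simp: K_def)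
      have "dist w c \<noteq> R"
      proof
        assume "dist w c = R"
        then have "h w = 0" by (simp add: h_def q)
        then show False using neg nonneg[OF wA] by simp
      qed
      moreover have "dist w c \<noteq> s"
      proof
        assume eq: "dist w c = s"
        then have "h w \<le> 1 / s\<^sup>2" by (simp add: h_def q)
        then have "e * h w \<le> e * (1 / s\<^sup>2)" using e by (intro mult_left_mono) auto
        also have "\<dots> = f c / 2" using s by (simp add: e_def)
        also have "\<dots> < f w" using s0(2)[of w] eq s by simp
        finally show False using neg by simp
      qed
      ultimately have dw: "s < dist w c" "dist w c < R" using dw by auto
      let ?B = "ball c R - cball c s"
      have B: "open ?B" "w \<in> ?B" using dw by (auto simp: dist_commute intro: open_Diff)
      have BK: "?B \<subseteq> K" and BA: "?B \<subseteq> A" using A by (auto simp: K_def)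
      obtain w1 w2 where w12: "w = (w1, w2)" by (cases w)
      have qB: "q v \<noteq> 0" if "v \<in> ?B" for v
        using that s q0[of v] by (cases "v = c") auto
      have Q1: "((\<lambda>s. q (s, t)) has_real_derivative 2 * (s - c1)) (at s)"
       and Q2: "((\<lambda>t. q (s, t)) has_real_derivative 2 * (t - c2)) (at t)" for s t
        unfolding q_def by (auto intro!: derivative_eq_intros)
      have H1: "((\<lambda>s. h (s, t)) has_real_derivative h1 (s, t)) (at s)"
       and H2: "((\<lambda>t. h (s, t)) has_real_derivative h2 (s, t)) (at t)"
       and H11: "((\<lambda>s. h1 (s, t)) has_real_derivative h11 (s, t)) (at s)"
       and H22: "((\<lambda>t. h2 (s, t)) has_real_derivative h22 (s, t)) (at t)"
       if "(s, t) \<in> ?B" for s t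
        unfolding h_def h1_def h2_def h11_def h22_def fst_conv snd_conv
        by (rule inverse_quadratic_derivs[OF Q1 qB[OF that]] inverse_quadratic_derivs[OF Q2 qB[OF that]])+
      have "(f11 w - e * h11 w) + (f22 w - e * h22 w) \<ge> 0"
        unfolding w12
      proof (rule laplacian_local_min[of ?B w1 w2 "\<lambda>v. f v - e * h v" "\<lambda>v. f1 v - e * h1 v" "\<lambda>v. f2 v - e * h2 v"])
        show "open ?B" "(w1, w2) \<in> ?B" using B w12 by auto
        show "\<forall>\<^sub>F v in nhds (w1, w2). f (w1, w2) - e * h (w1, w2) \<le> f v - e * h v"
          using eventually_nhds_in_open[OF B] unfolding w12
          by eventually_elim (use w BK w12 in blast)
      next
        fix s t assume st: "(s, t) \<in> ?B"
        then have stA: "(s, t) \<in> A" using BA by blast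
        show "((\<lambda>s. f (s, t) - e * h (s, t)) has_real_derivative f1 (s, t) - e * h1 (s, t)) (at s)"
          by (intro DERIV_diff DERIV_cmult f1 H1 st stA)
        show "((\<lambda>t. f (s, t) - e * h (s, t)) has_real_derivative f2 (s, t) - e * h2 (s, t)) (at t)"
          by (intro DERIV_diff DERIV_cmult f2 H2 st stA)
      next
        have w12B: "(w1, w2) \<in> ?B" "(w1, w2) \<in> A" using B w12 BA by auto
        show "((\<lambda>s. f1 (s, w2) - e * h1 (s, w2)) has_real_derivative f11 (w1, w2) - e * h11 (w1, w2)) (at w1)"
          by (intro DERIV_diff DERIV_cmult f11 H11 w12B)
        show "((\<lambda>t. f2 (w1, t) - e * h2 (w1, t)) has_real_derivative f22 (w1, w2) - e * h22 (w1, w2)) (at w2)"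
          by (intro DERIV_diff DERIV_cmult f22 H22 w12B)
      qed
      moreover have "h11 w + h22 w = 4 / (q w)\<^sup>2"
      proof -
        have "h11 w + h22 w = - 4 / (q w)\<^sup>2 + 8 * q w / (q w) ^ 3"
          by (simp add: h11_def h22_def q_def algebra_simps add_divide_distrib)
        then show ?thesis using qB[OF B(2)] by (simp add: field_simps power2_eq_square power3_eq_cube)
      qed
      then have "e * (h11 w + h22 w) > 0" using e qB[OF B(2)] by simp
      ultimately show False using super[OF wA] by (simp add: algebra_simps)
    qed
    then have "f z \<ge> e * h z" using w(2)[OF zK] by linarith
    moreover have "h z > 0"
    proof -
      have "0 < dist z c" "dist z c < R" using z far s by (auto simp: dist_commute)
      then show ?thesis by (simp add: h_def q frac_less2 power_strict_mono)
    qed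
    ultimately show ?thesis using e by (meson mult_pos_pos order_less_le_trans)
  qed
qed

section \<open>Moving lines\<close>

text \<open>\<open>S\<close> and \<open>Sb\<close> model a domain and its closure in logarithmic
  polar coordinates, with \<open>a\<close> and \<open>b\<close> the logarithms of the radii of two
  circles. \<open>star\<close> guarantees that reflections in the lines \<open>s = l\<close> with
  \<open>l <= b\<close> stay in the domain. \<open>periodic\<close> lets \<open>t\<close> be
  restricted to \<open>[0, 2 pi]\<close>, which restores compactness.\<close>

locale moving_lines =
  fixes S Sb :: "(real \<times> real) set" and V V1 V2 V11 V22 :: "real \<times> real \<Rightarrow> real"
    and a b M p :: real
  assumes open_S: "open S" and closed_Sb: "closed Sb" and S_subset: "S \<subseteq> Sb"
    and cont: "continuous_on Sb V"
    and periodic: "\<And>t. \<exists>t'\<in>{0..2*pi}. \<forall>s. ((s, t') \<in> S \<longleftrightarrow> (s, t) \<in> S) \<and>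
                     ((s, t') \<in> Sb \<longleftrightarrow> (s, t) \<in> Sb) \<and> V (s, t') = V (s, t)"
    and left: "\<And>z. z \<in> Sb \<Longrightarrow> a \<le> fst z"
    and star: "\<And>s s' t. (s, t) \<in> Sb \<Longrightarrow> s \<le> b \<Longrightarrow> s < s' \<Longrightarrow> s' \<le> s + 2 * (b - a) \<Longrightarrow> (s', t) \<in> S"
    and pos: "\<And>z. z \<in> S \<Longrightarrow> V z > 0"
    and zero: "\<And>z. z \<in> Sb \<Longrightarrow> z \<notin> S \<Longrightarrow> V z = 0"
    and bound: "\<And>z. z \<in> Sb \<Longrightarrow> V z \<le> M"
    and V1: "\<And>s t. (s, t) \<in> S \<Longrightarrow> ((\<lambda>s. V (s, t)) has_real_derivative V1 (s, t)) (at s)"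
    and V2: "\<And>s t. (s, t) \<in> S \<Longrightarrow> ((\<lambda>t. V (s, t)) has_real_derivative V2 (s, t)) (at t)"
    and V11: "\<And>s t. (s, t) \<in> S \<Longrightarrow> ((\<lambda>s. V1 (s, t)) has_real_derivative V11 (s, t)) (at s)"
    and V22: "\<And>s t. (s, t) \<in> S \<Longrightarrow> ((\<lambda>t. V2 (s, t)) has_real_derivative V22 (s, t)) (at t)"
    and equation: "\<And>z. z \<in> S \<Longrightarrow> V11 z + V22 z = - exp (2 * fst z) * V z powr p"
    and ab: "a < b" and p1: "1 \<le> p"
begin

section \<open>The reflected difference and its differential inequality\<close>

definition refl :: "real \<Rightarrow> real \<times> real \<Rightarrow> real \<times> real" where
  "refl l z = (2 * l - fst z, snd z)"

definition W :: "real \<Rightarrow> real \<times> real \<Rightarrow> real" where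
  "W l z = V (refl l z) - V z"

definition cap :: "real \<Rightarrow> (real \<times> real) set" where
  "cap l = {z \<in> S. fst z < l}"

definition W1 where "W1 l z = - V1 (refl l z) - V1 z"
definition W2 where "W2 l z = V2 (refl l z) - V2 z"
definition W11 where "W11 l z = V11 (refl l z) - V11 z"
definition W22 where "W22 l z = V22 (refl l z) - V22 z"

definition good :: "real \<Rightarrow> bool" where
  "good l \<longleftrightarrow> (\<forall>z\<in>Sb. fst z \<le> l \<longrightarrow> W l z \<ge> 0)"

lemma W_eq_0: "W (fst z) z = 0"
  by (simp add: W_def refl_def)

text \<open>The reflection moves \<open>z\<close> to the right by \<open>2 * (l - fst z)\<close>,
  which is at most \<open>2 * (b - a)\<close>, the range covered by \<open>star\<close>.\<close>

lemma refl_in_S: "z \<in> Sb \<Longrightarrow> fst z < l \<Longrightarrow> l \<le> b \<Longrightarrow> refl l z \<in> S"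
  using left[of z] by (auto simp: refl_def intro!: star[of "fst z" "snd z"])

lemma refl_in_Sb: "z \<in> Sb \<Longrightarrow> fst z \<le> l \<Longrightarrow> l \<le> b \<Longrightarrow> refl l z \<in> Sb"
  using refl_in_S[of z l] S_subset by (cases "fst z = l") (auto simp: refl_def)

lemma open_cap: "open (cap l)"
proof -
  have "cap l = S \<inter> fst -` {..<l}" by (auto simp: cap_def)
  then show ?thesis
    using open_S by (metis open_Int open_lessThan open_vimage_fst)
qed

lemma continuous_W:
  assumes "l \<le> b" "A \<subseteq> {z \<in> Sb. fst z \<le> l}"
  shows "continuous_on A (W l)"
proof -
  have "continuous_on A (\<lambda>z. V (refl l z))"
  proof (rule continuous_on_compose2[OF cont])
    show "continuous_on A (refl l)" unfolding refl_def by (intro continuous_intros)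
    show "refl l ` A \<subseteq> Sb" using assms refl_in_Sb by blast
  qed
  moreover have "continuous_on A V" using cont assms by (auto intro: continuous_on_subset)
  ultimately show ?thesis unfolding W_def by (intro continuous_intros)
qed

lemma W_periodic:
  obtains t' where "t' \<in> {0..2*pi}" "\<And>s. (s, t') \<in> Sb \<longleftrightarrow> (s, t) \<in> Sb" "\<And>l s. W l (s, t') = W l (s, t)"
  using periodic[of t] unfolding W_def refl_def by auto

lemma W_derivs:
  assumes "(s, t) \<in> cap l" "l \<le> b"
  shows "((\<lambda>s. W l (s, t)) has_real_derivative W1 l (s, t)) (at s)"
    and "((\<lambda>t. W l (s, t)) has_real_derivative W2 l (s, t)) (at t)"
    and "((\<lambda>s. W1 l (s, t)) has_real_derivative W11 l (s, t)) (at s)"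
    and "((\<lambda>t. W2 l (s, t)) has_real_derivative W22 l (s, t)) (at t)"
proof -
  have st: "(s, t) \<in> S" using assms by (auto simp: cap_def)
  have st': "(2 * l - s, t) \<in> S"
    using assms S_subset refl_in_S[of "(s, t)" l] by (auto simp: cap_def refl_def)
  have r: "((\<lambda>s. 2 * l - s) has_real_derivative -1) (at s)"
    by (auto intro!: derivative_eq_intros)
  note c1 = DERIV_chain2[OF V1[OF st'] r] and c11 = DERIV_chain2[OF V11[OF st'] r]
  show "((\<lambda>s. W l (s, t)) has_real_derivative W1 l (s, t)) (at s)"
    unfolding W_def W1_def refl_def using c1 V1[OF st] by (auto intro!: derivative_eq_intros)
  show "((\<lambda>t. W l (s, t)) has_real_derivative W2 l (s, t)) (at t)"
    unfolding W_def W2_def refl_def using V2[OF st'] V2[OF st] by (auto intro!: derivative_eq_intros)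
  show "((\<lambda>s. W1 l (s, t)) has_real_derivative W11 l (s, t)) (at s)"
    unfolding W1_def W11_def refl_def using c11 V11[OF st] by (auto intro!: derivative_eq_intros)
  show "((\<lambda>t. W2 l (s, t)) has_real_derivative W22 l (s, t)) (at t)"
    unfolding W2_def W22_def refl_def using V22[OF st'] V22[OF st] by (auto intro!: derivative_eq_intros)
qed

text \<open>The weight \<open>exp (2 s)\<close> is larger at the reflected point, so replacing it
  there by the weight at \<open>z\<close> can only increase the right side. What remains is a
  difference of \<open>p\<close>-th powers, nonpositive where \<open>W >= 0\<close> and controlled
  by the Lipschitz bound elsewhere. Hence \<open>W\<close> is superharmonic wherever it is
  nonnegative.\<close>

lemma W_laplacian_le:
  assumes z: "z \<in> cap l" and l: "l \<le> b"
  shows "W11 l z + W22 l z \<le> exp (2 * b) * p * M powr (p - 1) * max 0 (- W l z)"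
proof -
  have zS: "z \<in> S" "fst z < l" using z by (auto simp: cap_def)
  then have rS: "refl l z \<in> S" using refl_in_S S_subset l by blast
  have V: "V z > 0" "V (refl l z) > 0" "V z \<le> M" "V (refl l z) \<le> M"
    using pos bound S_subset zS rS by blast+
  have "W11 l z + W22 l z = exp (2 * fst z) * V z powr p - exp (2 * (2 * l - fst z)) * V (refl l z) powr p"
    using equation[OF zS(1)] equation[OF rS] by (simp add: W11_def W22_def) (simp add: refl_def)
  also have "\<dots> \<le> exp (2 * fst z) * V z powr p - exp (2 * fst z) * V (refl l z) powr p"
    using zS by (intro diff_left_mono mult_right_mono) auto
  also have "\<dots> = exp (2 * fst z) * (V z powr p - V (refl l z) powr p)"
    by (simp add: algebra_simps)
  also have "\<dots> \<le> exp (2 * b) * p * M powr (p - 1) * max 0 (- W l z)"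
  proof (cases "V z \<le> V (refl l z)")
    case True
    then have "V z powr p \<le> V (refl l z) powr p" using V p1 by (intro powr_mono2) auto
    then have "exp (2 * fst z) * (V z powr p - V (refl l z) powr p) \<le> 0"
      by (simp add: mult_nonneg_nonpos)
    also have "0 \<le> exp (2 * b) * p * M powr (p - 1) * max 0 (- W l z)"
      using p1 by simp
    finally show ?thesis .
  next
    case False
    have "V z powr p - V (refl l z) powr p \<le> p * M powr (p - 1) * (V z - V (refl l z))"
      using powr_diff_le False V p1 by simp
    moreover have "0 \<le> p * M powr (p - 1) * (V z - V (refl l z))"
      using False p1 by simp
    moreover have "exp (2 * fst z) \<le> exp (2 * b)" using zS l by simp
    ultimately have "exp (2 * fst z) * (V z powr p - V (refl l z) powr p)
        \<le> exp (2 * b) * (p * M powr (p - 1) * (V z - V (refl l z)))"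
      by (meson exp_ge_zero mult_left_mono mult_right_mono order_trans)
    then show ?thesis using False by (simp add: W_def mult_ac)
  qed
  finally show ?thesis .
qed

lemma W_pos_boundary:
  assumes "z \<in> Sb" "z \<notin> S" "fst z < l" "l \<le> b"
  shows "W l z > 0"
  using zero[OF assms(1,2)] pos[OF refl_in_S[OF assms(1,3,4)]] by (simp add: W_def)

text \<open>If \<open>W\<close> had a negative minimum relative to the positive barrier \<open>cos (k (l - s))\<close>, then \<open>W + m cos (k (l - s))\<close>
  would touch zero from above for some \<open>m > 0\<close>, and \<open>k\<^sup>2\<close> is too large for that.\<close>

lemma narrow:
  assumes l: "l \<le> b" and k: "k > 0" "k\<^sup>2 > exp (2 * b) * p * M powr (p - 1)"
    and l': "l' < l" "k * (l - l') < pi / 2"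
    and start: "\<And>z. z \<in> Sb \<Longrightarrow> fst z \<le> l' \<Longrightarrow> W l z \<ge> 0"
  shows "good l"
proof (rule ccontr)
  assume "\<not> good l"
  then obtain s0 t0 where z0: "(s0, t0) \<in> Sb" "s0 \<le> l" "W l (s0, t0) < 0"
    unfolding good_def by force
  obtain t0' where t0': "t0' \<in> {0..2*pi}" "(s0, t0') \<in> Sb" "W l (s0, t0') < 0"
    using W_periodic[of t0] z0 by metis
  define K where "K = Sb \<inter> ({l'..l} \<times> {0..2*pi})"
  have compK: "compact K"
    unfolding K_def using closed_Sb by (intro closed_Int_compact compact_Times) auto
  have z0K: "(s0, t0') \<in> K"
    using z0 t0' start[of "(s0, t0')"] by (force simp: K_def)
  \<comment> \<open>The barrier satisfies \<open>g'' = - k\<^sup>2 g\<close> in \<open>s\<close>,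
    and it is positive on the strip because the strip has width less than
    \<open>pi / (2 * k)\<close>.\<close>
  define g where "g z = cos (k * (l - fst z))" for z :: "real \<times> real"
  have g: "g z > 0" if "l' \<le> fst z" "fst z \<le> l" for z
    unfolding g_def
  proof (rule cos_gt_zero_pi)
    have "0 \<le> k * (l - fst z)" "k * (l - fst z) \<le> k * (l - l')"
      using k that by auto
    then show "- (pi / 2) < k * (l - fst z)" "k * (l - fst z) < pi / 2"
      using l' pi_gt_zero by linarith+
  qed
  have gK: "g z > 0" if "z \<in> K" for z using that by (intro g) (auto simp: K_def)
  \<comment> \<open>Minimising the quotient \<open>W / g\<close> finds the point where
    \<open>W + m * g\<close> touches zero. The minimum over \<open>K\<close> is one over the whole
    strip by periodicity.\<close>
  have "continuous_on K (\<lambda>z. W l z / g z)"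
  proof (intro continuous_intros)
    show "continuous_on K (W l)" by (rule continuous_W) (use l in \<open>auto simp: K_def\<close>)
    show "continuous_on K g" unfolding g_def by (intro continuous_intros)
    show "\<forall>z\<in>K. g z \<noteq> 0" using gK by force
  qed
  then obtain w where w: "w \<in> K" "\<And>z. z \<in> K \<Longrightarrow> W l w / g w \<le> W l z / g z"
    using continuous_attains_inf[OF compK] z0K by blast
  define m where "m = - (W l w / g w)"
  have "W l w / g w \<le> W l (s0, t0') / g (s0, t0')" using w z0K by blast
  also have "\<dots> < 0" using gK[OF z0K] t0' by (simp add: divide_neg_pos)
  finally have m: "m > 0" by (simp add: m_def)
  have Fw: "W l w + m * g w = 0" using gK[OF w(1)] by (simp add: m_def)
  then have Ww: "W l w < 0" using m gK[OF w(1)] by (smt (verit) mult_pos_pos)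
  have F: "W l z + m * g z \<ge> 0" if z: "z \<in> Sb" "l' \<le> fst z" "fst z \<le> l" for z
  proof -
    obtain t' where t': "t' \<in> {0..2*pi}" "(fst z, t') \<in> Sb" "W l (fst z, t') = W l z"
      using W_periodic[of "snd z"] z by (metis prod.collapse)
    have "(fst z, t') \<in> K" using t' z by (auto simp: K_def)
    then have "- m \<le> W l z / g z"
      using w(2)[of "(fst z, t')"] t' by (simp add: m_def g_def)
    then show ?thesis using g[OF z(2,3)] by (simp add: field_simps)
  qed
  have w': "w \<in> Sb" "l' \<le> fst w" "fst w \<le> l" using w by (auto simp: K_def)
  have "fst w \<noteq> l" using Ww W_eq_0[of w] by auto
  then have "fst w < l" using w' by simp
  have "fst w \<noteq> l'" using start[OF w'(1)] Ww by auto
  then have "l' < fst w" using w' by simp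
  have "w \<in> S" using W_pos_boundary[OF w'(1) _ \<open>fst w < l\<close> l] Ww by linarith
  let ?A = "cap l \<inter> fst -` {l'<..}"
  have A: "open ?A" using open_cap by (metis open_Int open_greaterThan open_vimage_fst)
  have wA: "w \<in> ?A" using \<open>w \<in> S\<close> \<open>fst w < l\<close> \<open>l' < fst w\<close> by (auto simp: cap_def)
  obtain w1 w2 where w12: "w = (w1, w2)" by (cases w)
  \<comment> \<open>At the touching point \<open>- W = m * g\<close>, so the minimum condition gives
    a Laplacian of \<open>W\<close> of at least \<open>k\<^sup>2 * (m * g)\<close>, whereas
    \<open>W_laplacian_le\<close> allows only a smaller multiple of \<open>m * g\<close>.\<close>
  have "(W11 l w - m * k\<^sup>2 * g w) + W22 l w \<ge> 0"
    unfolding w12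
  proof (rule laplacian_local_min[of ?A w1 w2 "\<lambda>z. W l z + m * g z"
            "\<lambda>z. W1 l z + m * k * sin (k * (l - fst z))" "W2 l"])
    show "open ?A" "(w1, w2) \<in> ?A" using A wA w12 by auto
    show "\<forall>\<^sub>F v in nhds (w1, w2). W l (w1, w2) + m * g (w1, w2) \<le> W l v + m * g v"
      using eventually_nhds_in_open[OF A wA] unfolding w12
    proof eventually_elim
      case (elim v)
      then show ?case using Fw F[of v] S_subset w12 by (auto simp: cap_def)
    qed
    fix s t assume "(s, t) \<in> ?A"
    then have st: "(s, t) \<in> cap l" by simp
    show "((\<lambda>s. W l (s, t) + m * g (s, t)) has_real_derivative
            W1 l (s, t) + m * k * sin (k * (l - fst (s, t)))) (at s)"
      unfolding g_def using W_derivs(1)[OF st l] by (auto intro!: derivative_eq_intros)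
    show "((\<lambda>t. W l (s, t) + m * g (s, t)) has_real_derivative W2 l (s, t)) (at t)"
      unfolding g_def using W_derivs(2)[OF st l] by (auto intro!: derivative_eq_intros)
  next
    have st: "(w1, w2) \<in> cap l" using wA w12 by simp
    show "((\<lambda>s. W1 l (s, w2) + m * k * sin (k * (l - fst (s, w2)))) has_real_derivative
            W11 l (w1, w2) - m * k\<^sup>2 * g (w1, w2)) (at w1)"
      unfolding g_def using W_derivs(3)[OF st l]
      by (auto intro!: derivative_eq_intros simp: power2_eq_square)
    show "((\<lambda>t. W2 l (w1, t)) has_real_derivative W22 l (w1, w2)) (at w2)"
      using W_derivs(4)[OF st l] .
  qed
  moreover have "W11 l w + W22 l w \<le> exp (2 * b) * p * M powr (p - 1) * (m * g w)"
    using W_laplacian_le[of w l] wA l Ww Fw by (smt (verit) Int_iff)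
  moreover have "exp (2 * b) * p * M powr (p - 1) * (m * g w) < k\<^sup>2 * (m * g w)"
    using k m gK[OF w(1)] by (intro mult_strict_right_mono) auto
  ultimately show False by (simp add: mult_ac)
qed

text \<open>Going left from \<open>z\<close> one meets the boundary, where \<open>W > 0\<close>; positivity then propagates back to \<open>z\<close>.\<close>

lemma good_strict:
  assumes l: "l \<le> b" "good l" and z: "z \<in> Sb" "fst z < l"
  shows "W l z > 0"
proof (cases "z \<in> S")
  case False
  then show ?thesis using W_pos_boundary l z by blast
next
  case True
  obtain s0 t where zst: "z = (s0, t)" by (cases z)
  have nonneg: "W l v \<ge> 0" if "v \<in> cap l" for v
    using that l(2) S_subset by (auto simp: good_def cap_def)
  \<comment> \<open>The supremum \<open>s1\<close> of \<open>T\<close> is the first parameter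
    outside \<open>S\<close> met when going left from \<open>z\<close>; being a limit of points of
    \<open>S\<close>, it gives a point of \<open>Sb\<close> outside \<open>S\<close>.\<close>
  define T where "T = {s. (s, t) \<notin> S} \<inter> {..s0}"
  have "open {s. (s, t) \<in> S}"
    using open_vimage[OF open_S, of "\<lambda>s. (s, t)", unfolded vimage_def]
      continuous_on_Pair[OF continuous_on_id continuous_on_const] by blast
  then have "closed T" unfolding T_def by (auto simp: Collect_neg_eq intro!: closed_Int)
  \<comment> \<open>First coordinates below \<open>a\<close> do not occur in \<open>Sb\<close>, so
    the ray does leave \<open>S\<close>.\<close>
  have "min (a - 1) s0 \<in> T"
    using left[of "(min (a - 1) s0, t)"] S_subset by (force simp: T_def)
  moreover have bdd: "bdd_above T" by (auto simp: T_def)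
  ultimately have "Sup T \<in> T"
    using \<open>closed T\<close> closed_contains_Sup by blast
  define s1 where "s1 = Sup T"
  have s1: "(s1, t) \<notin> S" "s1 \<le> s0" using \<open>Sup T \<in> T\<close> by (auto simp: T_def s1_def)
  have s1s0: "s1 < s0" using s1 True zst by (cases "s1 = s0") auto
  have inS: "(s, t) \<in> S" if "s1 < s" "s \<le> s0" for s
    using cSup_upper[OF _ bdd, of s] that by (force simp: T_def s1_def)
  have "(s1, t) \<in> Sb"
  proof (rule Lim_in_closed_set[OF closed_Sb])
    show "\<forall>\<^sub>F s in at_right s1. (s, t) \<in> Sb"
      using inS S_subset s1s0 by (intro eventually_at_rightI[of s1 s0]) auto
    show "((\<lambda>s. (s, t)) \<longlongrightarrow> (s1, t)) (at_right s1)" by (intro tendsto_intros)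
  qed auto
  have s0l: "s0 < l" using z zst by simp
  have W_s1: "W l (s1, t) > 0"
    by (rule W_pos_boundary) (use \<open>(s1, t) \<in> Sb\<close> s1 s0l l in auto)
  have segSb: "(s, t) \<in> Sb" if "s \<in> {s1..s0}" for s
    using that inS[of s] S_subset \<open>(s1, t) \<in> Sb\<close> by (cases "s = s1") auto
  have contw: "continuous_on {s1..s0} (\<lambda>s. W l (s, t))"
    by (rule continuous_on_compose2[OF continuous_W[OF l(1) order_refl]])
       (use segSb s0l in \<open>auto intro!: continuous_intros\<close>)
  show ?thesis
  proof (rule ccontr)
    assume neg: "\<not> W l z > 0"
    \<comment> \<open>Its infimum \<open>s2\<close> is the first parameter after \<open>s1\<close>
      at which \<open>W\<close> fails to be positive.\<close>
    define Q where "Q = {s \<in> {s1..s0}. W l (s, t) \<in> {..0}}"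
    have "closed Q"
      unfolding Q_def using continuous_closed_preimage[OF contw, of "{..0}"]
      by (simp add: vimage_def Int_def)
    moreover have "s0 \<in> Q" using neg zst s1s0 by (auto simp: Q_def)
    moreover have "bdd_below Q" by (auto simp: Q_def)
    ultimately have "Inf Q \<in> Q" using closed_contains_Inf by blast
    define s2 where "s2 = Inf Q"
    have s2: "s1 \<le> s2" "s2 \<le> s0" "W l (s2, t) \<le> 0"
      using \<open>Inf Q \<in> Q\<close> by (auto simp: Q_def s2_def)
    have "s1 \<noteq> s2" using s2 W_s1 by auto
    then have s12: "s1 < s2" using s2 by simp
    have before: "W l (s, t) > 0" if "s1 \<le> s" "s < s2" for s
      using cInf_lower[OF _ \<open>bdd_below Q\<close>, of s] that s2 by (force simp: Q_def s2_def)
    have "(s2, t) \<in> cap l" using inS[OF s12 s2(2)] s2 s0l by (auto simp: cap_def)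
    then obtain e where e: "e > 0" "cball (s2, t) e \<subseteq> cap l"
      using open_cap open_contains_cball by blast
    \<comment> \<open>The ball is centred slightly to the left of \<open>s2\<close>, where
      \<open>W\<close> is still positive. As \<open>h <= e / 4\<close>, the ball of radius
      \<open>e / 2\<close> contains \<open>(s2, t)\<close> and stays inside
      \<open>cball (s2, t) e\<close>.\<close>
    define h where "h = min (e / 4) ((s2 - s1) / 2)"
    have h: "0 < h" "h \<le> e / 4" "h < s2 - s1"
      using e s12 by (auto simp: h_def min_def)
    have d: "dist (s2 - h, t) (s2, t) = h" using h by (simp add: dist_Pair_Pair dist_real_def)
    have "cball (s2 - h, t) (e / 2) \<subseteq> cball (s2, t) e"
    proof
      fix v assume "v \<in> cball (s2 - h, t) (e / 2)"
      then have "dist (s2 - h, t) v \<le> e / 2" by simp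
      moreover have "dist (s2, t) v \<le> dist (s2, t) (s2 - h, t) + dist (s2 - h, t) v"
        by (rule dist_triangle)
      ultimately show "v \<in> cball (s2, t) e" using d h by (simp add: dist_commute)
    qed
    then have "cball (s2 - h, t) (e / 2) \<subseteq> cap l" using e by blast
    then have "W l (s2, t) > 0"
    proof (rule superharmonic_pos_on_ball[OF open_cap, where ?f1.0 = "W1 l" and ?f2.0 = "W2 l"
          and ?f11.0 = "W11 l" and ?f22.0 = "W22 l"])
      show "continuous_on (cap l) (W l)"
        by (rule continuous_W[OF l(1)]) (use S_subset in \<open>auto simp: cap_def\<close>)
      show "W11 l v + W22 l v \<le> 0" if "v \<in> cap l" for v
        using W_laplacian_le[OF that l(1)] nonneg[OF that] by simp
      show "W l (s2 - h, t) > 0" using before h by simp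
      show "(s2, t) \<in> ball (s2 - h, t) (e / 2)" using d h e by simp
    qed (use W_derivs l nonneg in auto)
    then show False using s2 by simp
  qed
qed

text \<open>At distance at least \<open>h\<close> to the left of the line, \<open>W\<close> is
  strictly positive by \<open>good_strict\<close>, and by compactness it stays so when the line
  moves a little. The strip that remains is narrow enough for \<open>narrow\<close>.\<close>

lemma good_continues:
  assumes l: "l < b" "good l" and k: "k > 0" "k\<^sup>2 > exp (2 * b) * p * M powr (p - 1)"
  obtains e where "e > 0" "\<And>l'. l \<le> l' \<Longrightarrow> l' < l + e \<Longrightarrow> l' \<le> b \<Longrightarrow> good l'"
proof -
  \<comment> \<open>After a move of less than \<open>h\<close> the uncontrolled strip has width
    below \<open>2 * h\<close>, and \<open>k * (2 * h) = 1 < pi / 2\<close>.\<close>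
  define h where "h = 1 / (2 * k)"
  have h: "h > 0" "k * h = 1 / 2" using k by (auto simp: h_def)
  define K where "K = {l..b} \<times> (Sb \<inter> ({a..l - h} \<times> {0..2*pi}))"
  have compK: "compact K"
    unfolding K_def using closed_Sb by (intro closed_Int_compact compact_Times) auto
  have contK: "continuous_on K (\<lambda>x. W (fst x) (snd x))"
  proof -
    have "continuous_on K (\<lambda>x. V (refl (fst x) (snd x)))"
    proof (rule continuous_on_compose2[OF cont])
      show "continuous_on K (\<lambda>x. refl (fst x) (snd x))" unfolding refl_def by (intro continuous_intros)
      show "(\<lambda>x. refl (fst x) (snd x)) ` K \<subseteq> Sb"
        using h by (auto simp: K_def intro!: refl_in_Sb)
    qed
    moreover have "continuous_on K (\<lambda>x. V (snd x))"
      by (rule continuous_on_compose2[OF cont]) (auto simp: K_def intro!: continuous_intros)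
    ultimately show ?thesis unfolding W_def by (intro continuous_intros)
  qed
  \<comment> \<open>\<open>N\<close> collects the pairs of line position and point at which
    positivity fails. It is compact and has no pair with position \<open>l\<close>, so its positions
    are bounded away from \<open>l\<close>.\<close>
  define N where "N = {x \<in> K. W (fst x) (snd x) \<in> {..0}}"
  have "compact N"
  proof -
    have "closed N"
      unfolding N_def using continuous_closed_preimage[OF contK compact_imp_closed[OF compK], of "{..0}"]
      by (simp add: vimage_def Int_def)
    then have "compact (K \<inter> N)" using compK by (rule compact_Int_closed[rotated])
    moreover have "K \<inter> N = N" by (auto simp: N_def)
    ultimately show ?thesis by simp
  qed
  have "\<exists>d>0. \<forall>x\<in>N. fst x \<ge> l + d"
  proof (cases "N = {}")
    case True
    then show ?thesis by (intro exI[of _ 1]) auto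
  next
    case False
    obtain x where x: "x \<in> N" "\<And>y. y \<in> N \<Longrightarrow> fst x \<le> fst y"
      using continuous_attains_inf[OF \<open>compact N\<close> False continuous_on_fst[OF continuous_on_id]] by blast
    have "fst x > l"
    proof (rule ccontr)
      assume "\<not> fst x > l"
      then have "fst x = l" "snd x \<in> Sb" "fst (snd x) < l" using x h by (auto simp: N_def K_def)
      then show False using good_strict[of l "snd x"] l x by (auto simp: N_def)
    qed
    then show ?thesis using x(2) by (intro exI[of _ "fst x - l"]) auto
  qed
  then obtain d where d: "d > 0" "\<And>x. x \<in> N \<Longrightarrow> fst x \<ge> l + d" by blast
  show ?thesis
  proof (rule that[of "min d h"])
    show "min d h > 0" using d h by simp
    fix l' assume l': "l \<le> l'" "l' < l + min d h" "l' \<le> b"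
    show "good l'"
    proof (rule narrow[OF l'(3) k, of "l - h"])
      show "l - h < l'" using l' h by simp
      have "k * (l' - (l - h)) < k * (2 * h)" using l' k by (intro mult_strict_left_mono) auto
      also have "\<dots> = 1" using h by simp
      finally show "k * (l' - (l - h)) < pi / 2" using pi_gt3 by linarith
      fix z assume z: "z \<in> Sb" "fst z \<le> l - h"
      obtain t' where t': "t' \<in> {0..2*pi}" "(fst z, t') \<in> Sb" "W l' (fst z, t') = W l' z"
        using W_periodic[of "snd z"] z by (metis prod.collapse)
      have "(l', (fst z, t')) \<in> K" using t' z l' left[OF z(1)] by (auto simp: K_def)
      moreover have "(l', (fst z, t')) \<notin> N" using d(2)[of "(l', (fst z, t'))"] l' by auto
      ultimately show "W l' z \<ge> 0" using t' by (auto simp: N_def)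
    qed
  qed
qed

text \<open>This is a continuity argument on the infimum \<open>l\<close> of the bad positions:
  \<open>l > a\<close> since the first strip is narrow, \<open>l\<close> itself is good as a limit
  of good positions, and \<open>good_continues\<close> then pushes the infimum further
  right.\<close>

lemma good_b: "good b"
proof (rule ccontr)
  assume bad: "\<not> good b"
  \<comment> \<open>The summand 1 gives \<open>k >= 1\<close>, so \<open>k\<^sup>2 >= k\<close>
    exceeds the constant of \<open>narrow\<close>.\<close>
  define k where "k = exp (2 * b) * p * M powr (p - 1) + 1"
  have C0: "0 \<le> exp (2 * b) * p * M powr (p - 1)" using p1 by simp
  then have k: "k > 0" by (simp add: k_def)
  have k2: "k\<^sup>2 > exp (2 * b) * p * M powr (p - 1)"
  proof -
    have "k * 1 \<le> k * k" using C0 by (intro mult_left_mono) (auto simp: k_def)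
    moreover have "exp (2 * b) * p * M powr (p - 1) < k" by (simp add: k_def)
    ultimately show ?thesis by (simp add: power2_eq_square)
  qed
  define B where "B = {l. a < l \<and> l \<le> b \<and> \<not> good l}"
  have bB: "b \<in> B" using bad ab by (simp add: B_def)
  have bdd: "bdd_below B" by (auto simp: B_def intro!: bdd_belowI[of _ a])
  define l where "l = Inf B"
  \<comment> \<open>For such positions the strip of width \<open>1 / k\<close> reaches beyond
    \<open>a\<close>, so the hypothesis of \<open>narrow\<close> to the left of it holds
    vacuously.\<close>
  have "a + 1 / k \<le> l'" if "l' \<in> B" for l'
  proof (rule ccontr)
    assume "\<not> a + 1 / k \<le> l'"
    then have l': "a < l'" "l' < a + 1 / k" "l' \<le> b" "\<not> good l'" using that by (auto simp: B_def)
    have "l' - 1 / k < a" using l' by simp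
    have "good l'"
    proof (rule narrow[OF l'(3) k k2, of "l' - 1 / k"])
      show "k * (l' - (l' - 1 / k)) < pi / 2" using k pi_gt3 by simp
      show "W l' z \<ge> 0" if "z \<in> Sb" "fst z \<le> l' - 1 / k" for z
        using left[OF that(1)] that \<open>l' - 1 / k < a\<close> by simp
    qed (use k in simp)
    then show False using l' by simp
  qed
  then have "a + 1 / k \<le> l" unfolding l_def using bB by (intro cInf_greatest) auto
  then have al: "a < l" using k by (smt (verit) divide_pos_pos)
  have lb: "l \<le> b" unfolding l_def using cInf_lower[OF bB bdd] .
  have below: "good l'" if "a < l'" "l' < l" for l'
  proof (rule ccontr)
    assume "\<not> good l'"
    then have "l' \<in> B" using that lb by (auto simp: B_def)
    then have "l \<le> l'" unfolding l_def by (rule cInf_lower[OF _ bdd])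
    then show False using that by simp
  qed
  have "good l"
    unfolding good_def
  proof (intro ballI impI)
    fix z assume z: "z \<in> Sb" "fst z \<le> l"
    show "W l z \<ge> 0"
    proof (cases "fst z = l")
      case True
      then show ?thesis using W_eq_0 by (metis order_refl)
    next
      case False
      then have zl: "fst z < l" using z by simp
      \<comment> \<open>The reflected point lies in \<open>S\<close>, where \<open>V\<close> is
        differentiable in \<open>s\<close>; so \<open>W l z\<close> is continuous in
        \<open>l\<close> for fixed \<open>z\<close>, and nonnegativity passes to the limit from the
        left.\<close>
      have "(2 * l - fst z, snd z) \<in> S" using refl_in_S[OF z(1) zl lb] by (simp add: refl_def)
      note c = DERIV_isCont[OF V1[OF this]]
      have "isCont (\<lambda>l. 2 * l - fst z) l" by (intro continuous_intros)
      from isCont_o2[OF this c] have "isCont (\<lambda>l. V (2 * l - fst z, snd z)) l" .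
      then have "isCont (\<lambda>l. W l z) l" unfolding W_def refl_def by (intro continuous_intros)
      then have "((\<lambda>l. W l z) \<longlongrightarrow> W l z) (at_left l)"
        unfolding isCont_def by (rule tendsto_within_subset) auto
      then show ?thesis
      proof (rule tendsto_lowerbound)
        show "\<forall>\<^sub>F l' in at_left l. W l' z \<ge> 0"
          using below zl al z by (intro eventually_at_leftI[of "max a (fst z)"]) (auto simp: good_def)
      qed auto
    qed
  qed
  then have "l < b" using lb bad by (cases "l = b") auto
  then obtain e where e: "e > 0" "\<And>l'. l \<le> l' \<Longrightarrow> l' < l + e \<Longrightarrow> l' \<le> b \<Longrightarrow> good l'"
    using good_continues[OF _ \<open>good l\<close> k k2] by blast
  have "l + e \<le> l'" if "l' \<in> B" for l'
  proof (rule ccontr)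
    assume "\<not> l + e \<le> l'"
    moreover have "l \<le> l'" unfolding l_def by (rule cInf_lower[OF that bdd])
    ultimately show False using e(2)[of l'] that by (auto simp: B_def)
  qed
  then have "l + e \<le> l" unfolding l_def using bB by (intro cInf_greatest) auto
  then show False using e by simp
qed

lemma reflection_greater:
  assumes "(s, t) \<in> Sb" "s < b"
  shows "V (s, t) < V (2 * b - s, t)"
  using good_strict[OF order_refl good_b, of "(s, t)"] assms by (simp add: W_def refl_def)

end

section \<open>Logarithmic polar coordinates\<close>

definition circ :: "real \<Rightarrow> real ^ 2" where
  "circ t = cos t *\<^sub>R axis 1 1 + sin t *\<^sub>R axis 2 1"

definition circ' :: "real \<Rightarrow> real ^ 2" where
  "circ' t = - sin t *\<^sub>R axis 1 1 + cos t *\<^sub>R axis 2 1"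

definition log_polar :: "real ^ 2 \<Rightarrow> real \<times> real \<Rightarrow> real ^ 2" where
  "log_polar c z = c + exp (fst z) *\<^sub>R circ (snd z)"

lemma circ_nth [simp]: "circ t $ 1 = cos t" "circ t $ 2 = sin t"
  by (simp_all add: circ_def axis_def)

lemma norm_circ [simp]: "norm (circ t) = 1"
  by (simp add: norm_vec_def L2_set_def UNIV_2)

lemma dist_log_polar [simp]: "dist (log_polar c z) c = exp (fst z)"
  by (simp add: log_polar_def dist_norm)

lemma continuous_on_circ [continuous_intros]:
  fixes f :: "'a::metric_space \<Rightarrow> real"
  shows "continuous_on A f \<Longrightarrow> continuous_on A (\<lambda>x. circ (f x))"
  "continuous_on A f \<Longrightarrow> continuous_on A (\<lambda>x. circ' (f x))"
  unfolding circ_def circ'_def by (auto intro!: continuous_intros)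

lemma continuous_on_log_polar [continuous_intros]:
  fixes f :: "'a::metric_space \<Rightarrow> real \<times> real"
  shows "continuous_on A f \<Longrightarrow> continuous_on A (\<lambda>x. log_polar c (f x))"
  unfolding log_polar_def by (intro continuous_intros)

lemma circ_derivs:
  "(circ has_vector_derivative circ' t) (at t within A)"
  "(circ' has_vector_derivative - circ t) (at t within A)"
  unfolding circ_def circ'_def by (auto intro!: derivative_eq_intros simp: has_vector_derivative_def algebra_simps)

lemma log_polar_surj:
  assumes "x \<noteq> c"
  obtains t where "0 \<le> t" "t < 2 * pi" "x = log_polar c (ln (dist x c), t)"
proof -
  define r where "r = dist x c"
  have r: "r > 0" using assms by (simp add: r_def)
  have "((x - c) $ 1 / r)\<^sup>2 + ((x - c) $ 2 / r)\<^sup>2 = 1"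
  proof -
    have "r\<^sup>2 = ((x - c) $ 1)\<^sup>2 + ((x - c) $ 2)\<^sup>2"
      by (simp add: r_def dist_norm norm_vec_def L2_set_def UNIV_2)
    moreover have "((x - c) $ 1 / r)\<^sup>2 + ((x - c) $ 2 / r)\<^sup>2 = (((x - c) $ 1)\<^sup>2 + ((x - c) $ 2)\<^sup>2) / r\<^sup>2"
      by (simp add: power_divide add_divide_distrib)
    ultimately have "((x - c) $ 1 / r)\<^sup>2 + ((x - c) $ 2 / r)\<^sup>2 = r\<^sup>2 / r\<^sup>2" by (simp only:)
    then show ?thesis using r by simp
  qed
  then obtain t where t: "0 \<le> t" "t < 2 * pi" "(x - c) $ 1 / r = cos t" "(x - c) $ 2 / r = sin t"
    using sincos_total_2pi by metis
  have "x = log_polar c (ln (dist x c), t)"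
    using t r by (simp add: vec_eq_iff forall_2 log_polar_def flip: r_def) (simp add: field_simps)
  then show ?thesis using that t by blast
qed

section \<open>Derivatives along curves and conformal invariance of the Laplacian\<close>

locale twice_differentiable =
  fixes A :: "(real ^ 2) set" and u :: "real ^ 2 \<Rightarrow> real"
    and u' :: "real ^ 2 \<Rightarrow> (real ^ 2) \<Rightarrow>\<^sub>L real"
    and u'' :: "real ^ 2 \<Rightarrow> (real ^ 2) \<Rightarrow>\<^sub>L ((real ^ 2) \<Rightarrow>\<^sub>L real)"
  assumes open_A: "open A"
    and u': "\<And>x. x \<in> A \<Longrightarrow> (u has_derivative u' x) (at x)"
    and u'': "\<And>x. x \<in> A \<Longrightarrow> (u' has_derivative u'' x) (at x)"
    and cont_u'': "continuous_on A u''"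
begin

lemma continuous_u: "continuous_on A u"
  using u' by (meson continuous_at_imp_continuous_on has_derivative_continuous)

lemma continuous_u': "continuous_on A u'"
  using u'' by (meson continuous_at_imp_continuous_on has_derivative_continuous)

lemma u_curve:
  assumes "(g has_vector_derivative v) (at s)" "g s \<in> A"
  shows "((\<lambda>s. u (g s)) has_real_derivative u' (g s) v) (at s)"
proof -
  have "((\<lambda>s. u (g s)) has_derivative (\<lambda>h. u' (g s) (h *\<^sub>R v))) (at s)"
    using has_derivative_compose[OF assms(1)[unfolded has_vector_derivative_def] u'[OF assms(2)]] .
  then show ?thesis
    by (simp add: has_field_derivative_def blinfun.scaleR_right mult.commute[of _ "u' (g s) v"])
qed

lemma u'_curve:
  assumes g: "(g has_vector_derivative v) (at s)" "g s \<in> A"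
    and w: "(w has_vector_derivative w') (at s)"
  shows "((\<lambda>s. u' (g s) (w s)) has_real_derivative u'' (g s) v (w s) + u' (g s) w') (at s)"
proof -
  have 1: "((\<lambda>s. u' (g s)) has_derivative (\<lambda>h. u'' (g s) (h *\<^sub>R v))) (at s)"
    using has_derivative_compose[OF g(1)[unfolded has_vector_derivative_def] u''[OF g(2)]] .
  show ?thesis
    using blinfun.FDERIV[OF 1 w[unfolded has_vector_derivative_def]]
    unfolding has_field_derivative_def
    by (rule has_derivative_eq_rhs)
       (auto simp: blinfun.scaleR_right blinfun.scaleR_left algebra_simps)
qed

lemma partial_deriv_eq:
  assumes "x \<in> A"
  shows "partial_deriv i u x = u' x (axis i 1)"
proof -
  have "((\<lambda>t. x + t *\<^sub>R axis i 1) has_vector_derivative axis i 1) (at 0)"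
    by (auto intro!: derivative_eq_intros simp: has_vector_derivative_def)
  from u_curve[OF this] assms show ?thesis
    unfolding partial_deriv_def by (auto intro: DERIV_imp_deriv)
qed

text \<open>The inner partial derivative has to be identified on a whole neighbourhood of the point
  before the outer \<open>deriv\<close> can be computed; openness of \<open>A\<close> provides
  it.\<close>

lemma laplacian_eq:
  assumes "x \<in> A"
  shows "laplacian u x = u'' x (axis 1 1) (axis 1 1) + u'' x (axis 2 1) (axis 2 1)"
proof -
  have "partial_deriv i (partial_deriv i u) x = u'' x (axis i 1) (axis i 1)" for i
  proof -
    have g: "((\<lambda>t. x + t *\<^sub>R axis i 1) has_vector_derivative axis i 1) (at 0)"
      by (auto intro!: derivative_eq_intros simp: has_vector_derivative_def)
    have D: "((\<lambda>t. u' (x + t *\<^sub>R axis i 1) (axis i 1)) has_real_derivative u'' x (axis i 1) (axis i 1)) (at 0)"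
      using u'_curve[OF g, of "\<lambda>_. axis i 1" 0] assms by simp
    have "((\<lambda>t. x + t *\<^sub>R axis i 1) \<longlongrightarrow> x) (nhds (0 :: real))"
      by (auto intro!: tendsto_eq_intros filterlim_ident)
    then have "\<forall>\<^sub>F t in nhds (0 :: real). x + t *\<^sub>R axis i 1 \<in> A"
      using open_A assms by (rule topological_tendstoD)
    then have ev: "\<forall>\<^sub>F t in nhds (0 :: real). partial_deriv i u (x + t *\<^sub>R axis i 1) = u' (x + t *\<^sub>R axis i 1) (axis i 1)"
      by eventually_elim (rule partial_deriv_eq)
    show ?thesis
      unfolding partial_deriv_def[of i "partial_deriv i u"]
      by (rule DERIV_imp_deriv) (use D DERIV_cong_ev[OF refl ev refl] in simp)
  qed
  then show ?thesis by (simp add: laplacian_def UNIV_2)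
qed

text \<open>The trace of the Hessian is the same in every orthonormal basis. Each of the two mixed
  terms cancels by itself, without appeal to their equality.\<close>

lemma rotated_laplacian:
  assumes "x \<in> A"
  shows "u'' x (circ t) (circ t) + u'' x (circ' t) (circ' t) = laplacian u x"
proof -
  let ?a = "u'' x (axis 1 1) (axis 1 1)" and ?d = "u'' x (axis 2 1) (axis 2 1)"
    and ?b = "u'' x (axis 1 1) (axis 2 1)" and ?c = "u'' x (axis 2 1) (axis 1 1)"
  have 1: "u'' x (circ t) (circ t) = cos t * (cos t * ?a + sin t * ?b) + sin t * (cos t * ?c + sin t * ?d)"
    by (simp add: circ_def blinfun.bilinear_simps algebra_simps)
  have 2: "u'' x (circ' t) (circ' t) = sin t * (sin t * ?a - cos t * ?b) + cos t * (- sin t * ?c + cos t * ?d)"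
    by (simp add: circ'_def blinfun.bilinear_simps algebra_simps)
  have "C * (C * a + S * b) + S * (C * c + S * d) + (S * (S * a - C * b) + C * (- S * c + C * d))
      = (S\<^sup>2 + C\<^sup>2) * (a + d)" for C S a b c d :: real
    by algebra
  then show ?thesis unfolding 1 2 laplacian_eq[OF assms] by simp
qed

definition P1 where "P1 c z = exp (fst z) * u' (log_polar c z) (circ (snd z))"
definition P2 where "P2 c z = exp (fst z) * u' (log_polar c z) (circ' (snd z))"
definition P11 where
  "P11 c z = (exp (fst z))\<^sup>2 * u'' (log_polar c z) (circ (snd z)) (circ (snd z)) + P1 c z"
definition P22 where
  "P22 c z = (exp (fst z))\<^sup>2 * u'' (log_polar c z) (circ' (snd z)) (circ' (snd z)) - P1 c z"

lemma log_polar_derivs: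
  "((\<lambda>s. log_polar c (s, t)) has_vector_derivative exp s *\<^sub>R circ t) (at s)"
  "((\<lambda>t. log_polar c (s, t)) has_vector_derivative exp s *\<^sub>R circ' t) (at t)"
  "((\<lambda>s. exp s *\<^sub>R circ t) has_vector_derivative exp s *\<^sub>R circ t) (at s)"
  "((\<lambda>t. exp s *\<^sub>R circ' t) has_vector_derivative - exp s *\<^sub>R circ t) (at t)"
proof -
  show 1: "((\<lambda>s. exp s *\<^sub>R circ t) has_vector_derivative exp s *\<^sub>R circ t) (at s)"
    by (auto intro!: derivative_eq_intros)
  show 2: "((\<lambda>t. exp s *\<^sub>R circ' t) has_vector_derivative - exp s *\<^sub>R circ t) (at t)"
    using has_vector_derivative_scaleR[OF DERIV_const circ_derivs(2)] by simp
  have 3: "((\<lambda>t. exp s *\<^sub>R circ t) has_vector_derivative exp s *\<^sub>R circ' t) (at t)"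
    using has_vector_derivative_scaleR[OF DERIV_const circ_derivs(1)] by simp
  show "((\<lambda>s. log_polar c (s, t)) has_vector_derivative exp s *\<^sub>R circ t) (at s)"
    using has_vector_derivative_add[OF has_vector_derivative_const 1, of c] by (simp add: log_polar_def)
  show "((\<lambda>t. log_polar c (s, t)) has_vector_derivative exp s *\<^sub>R circ' t) (at t)"
    using has_vector_derivative_add[OF has_vector_derivative_const 3, of c] by (simp add: log_polar_def)
qed

lemma u_log_polar_derivs:
  assumes "log_polar c (s, t) \<in> A"
  shows "((\<lambda>s. u (log_polar c (s, t))) has_real_derivative P1 c (s, t)) (at s)"
    and "((\<lambda>t. u (log_polar c (s, t))) has_real_derivative P2 c (s, t)) (at t)"
    and "((\<lambda>s. P1 c (s, t)) has_real_derivative P11 c (s, t)) (at s)"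
    and "((\<lambda>t. P2 c (s, t)) has_real_derivative P22 c (s, t)) (at t)"
  using u_curve[OF log_polar_derivs(1)] u_curve[OF log_polar_derivs(2)]
    u'_curve[OF log_polar_derivs(1) _ log_polar_derivs(3)]
    u'_curve[OF log_polar_derivs(2) _ log_polar_derivs(4)] assms
  unfolding P1_def P2_def P11_def P22_def
  by (simp_all add: blinfun.bilinear_simps power2_eq_square mult.assoc)

text \<open>The first-order terms of \<open>P11\<close> and \<open>P22\<close> are \<open>P1\<close>
  and \<open>- P1\<close>: the exponential radius produces one, the curvature of the circle the
  other. Their cancellation is what makes the change of variables conformal.\<close>

lemma log_polar_laplacian:
  assumes "log_polar c z \<in> A"
  shows "P11 c z + P22 c z = exp (2 * fst z) * laplacian u (log_polar c z)"
  using rotated_laplacian[OF assms, of "snd z"]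
  by (simp add: P11_def P22_def exp_double flip: distrib_left)

text \<open>Continuity of \<open>P1\<close> and \<open>P11\<close> justifies differentiating the
  circle integrals under the integral sign in \<open>max_bound\<close>.\<close>

lemma continuous_P:
  assumes "\<And>z. z \<in> B \<Longrightarrow> log_polar c z \<in> A"
  shows "continuous_on B (P1 c)" and "continuous_on B (P11 c)"
    and "continuous_on B (\<lambda>z. u (log_polar c z))"
proof -
  have id: "continuous_on B (\<lambda>z. log_polar c z)" by (intro continuous_intros)
  have "continuous_on B (\<lambda>z. u' (log_polar c z))" "continuous_on B (\<lambda>z. u'' (log_polar c z))"
    and 3: "continuous_on B (\<lambda>z. u (log_polar c z))"
    using assms by (auto intro!: continuous_on_compose2[OF continuous_u' id]
      continuous_on_compose2[OF cont_u'' id] continuous_on_compose2[OF continuous_u id])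
  then show "continuous_on B (P1 c)" "continuous_on B (P11 c)" "continuous_on B (\<lambda>z. u (log_polar c z))"
    unfolding P1_def P11_def by (auto intro!: continuous_intros)
qed

end

section \<open>Estimates for solutions\<close>

context twice_differentiable
begin

text \<open>This is the moving line result with \<open>a = ln r\<close> and \<open>b = ln R\<close>.
  A shift by \<open>s' - s\<close> in \<open>s\<close> is a dilation about \<open>c\<close> with
  factor \<open>exp (s' - s)\<close>, and \<open>(R / r)\<^sup>2 = exp (2 * (b - a))\<close>. The
  larger value is attained at the inverse of \<open>x\<close> in the circle of radius
  \<open>R\<close>.\<close>

lemma reflection_in_circle:
  assumes cont: "continuous_on (closure A) u"
    and pos: "\<And>x. x \<in> A \<Longrightarrow> u x > 0"
    and zero: "\<And>x. x \<in> frontier A \<Longrightarrow> u x = 0"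
    and eq: "\<And>x. x \<in> A \<Longrightarrow> laplacian u x = - (u x powr p)"
    and bound: "\<And>x. x \<in> closure A \<Longrightarrow> u x \<le> M"
    and p: "1 \<le> p" and R: "0 < r" "r < R"
    and outside: "\<And>x. x \<in> closure A \<Longrightarrow> r \<le> dist x c"
    and star: "\<And>x k. x \<in> closure A \<Longrightarrow> dist x c \<le> R \<Longrightarrow> 1 < k \<Longrightarrow> k \<le> (R / r)\<^sup>2 \<Longrightarrow>
                 c + k *\<^sub>R (x - c) \<in> A"
    and x: "x \<in> A" "dist x c < R"
  shows "\<exists>y\<in>A. u x < u y"
proof -
  have contP: "continuous_on UNIV (log_polar c)"
    using continuous_on_log_polar[OF continuous_on_id] by simp
  interpret moving_lines "log_polar c -` A" "log_polar c -` closure A" "\<lambda>z. u (log_polar c z)"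
    "P1 c" "P2 c" "P11 c" "P22 c" "ln r" "ln R" M p
  proof
    show "open (log_polar c -` A)" using open_A contP by (rule open_vimage)
    show "closed (log_polar c -` closure A)" using closed_closure contP by (rule closed_vimage)
    show "log_polar c -` A \<subseteq> log_polar c -` closure A" using closure_subset by blast
    show "continuous_on (log_polar c -` closure A) (\<lambda>z. u (log_polar c z))"
      by (rule continuous_on_compose2[OF cont]) (auto intro: continuous_on_subset[OF contP])
    show "\<exists>t'\<in>{0..2 * pi}. \<forall>s. ((s, t') \<in> log_polar c -` A) = ((s, t) \<in> log_polar c -` A) \<and>
            ((s, t') \<in> log_polar c -` closure A) = ((s, t) \<in> log_polar c -` closure A) \<and>
            u (log_polar c (s, t')) = u (log_polar c (s, t))" for t
    proof -
      obtain t' where t': "0 \<le> t'" "t' < 2 * pi" "cos t = cos t'" "sin t = sin t'"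
        using sincos_total_2pi[of "cos t" "sin t"] by (metis sin_cos_squared_add2 add.commute)
      then have "log_polar c (s, t') = log_polar c (s, t)" for s
        by (simp add: log_polar_def circ_def)
      then show ?thesis using t' by (intro bexI[of _ t']) auto
    qed
    show "ln r \<le> fst z" if "z \<in> log_polar c -` closure A" for z
    proof -
      have "r \<le> exp (fst z)" using outside[of "log_polar c z"] that by simp
      then show ?thesis using R by (metis ln_exp ln_le_cancel_iff exp_gt_zero)
    qed
    show "(s', t) \<in> log_polar c -` A"
      if st: "(s, t) \<in> log_polar c -` closure A" "s \<le> ln R" "s < s'" "s' \<le> s + 2 * (ln R - ln r)" for s s' t
    proof -
      have "c + exp (s' - s) *\<^sub>R (log_polar c (s, t) - c) \<in> A"
      proof (rule star)
        show "log_polar c (s, t) \<in> closure A" using st by simp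
        have "exp s \<le> exp (ln R)" using st by simp
        then show "dist (log_polar c (s, t)) c \<le> R" using R by simp
        show "1 < exp (s' - s)" using st by simp
        have "exp (s' - s) \<le> exp (2 * (ln R - ln r))" using st by simp
        also have "\<dots> = (R / r)\<^sup>2" using R by (simp add: exp_double exp_diff power_divide)
        finally show "exp (s' - s) \<le> (R / r)\<^sup>2" .
      qed
      also have "c + exp (s' - s) *\<^sub>R (log_polar c (s, t) - c) = log_polar c (s', t)"
        by (simp add: log_polar_def flip: exp_add)
      finally show ?thesis by simp
    qed
    show "u (log_polar c z) = 0" if "z \<in> log_polar c -` closure A" "z \<notin> log_polar c -` A" for z
      using that zero open_A by (simp add: frontier_def interior_open)
    show "P11 c z + P22 c z = - exp (2 * fst z) * u (log_polar c z) powr p" if "z \<in> log_polar c -` A" for z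
      using log_polar_laplacian[of c z] eq that by simp
  qed (use pos bound p R u_log_polar_derivs in auto)
  have "x \<noteq> c" using outside[of x] x R closure_subset[of A] by auto
  then obtain t where t: "x = log_polar c (ln (dist x c), t)" using log_polar_surj by blast
  have dx: "ln (dist x c) < ln R" using x R \<open>x \<noteq> c\<close> by simp
  have in_Sb: "(ln (dist x c), t) \<in> log_polar c -` closure A" using t x closure_subset[of A] by auto
  have "u x < u (log_polar c (2 * ln R - ln (dist x c), t))"
    using reflection_greater[OF in_Sb dx] t by simp
  moreover have "log_polar c (2 * ln R - ln (dist x c), t) \<in> A"
    using refl_in_S[OF in_Sb, of "ln R"] dx by (simp add: refl_def)
  ultimately show ?thesis by blast
qed

text \<open>The factor \<open>exp (12 * p)\<close> grows with \<open>p\<close>, but its root of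
  order \<open>p - 1\<close> stays bounded for \<open>p\<close> away from 1; this is why the power
  \<open>p - 1\<close> of the maximum is estimated.\<close>

lemma max_bound:
  assumes pos: "\<And>x. x \<in> A \<Longrightarrow> u x > 0"
    and eq: "\<And>x. x \<in> A \<Longrightarrow> laplacian u x = - (u x powr p)"
    and max: "\<And>x. x \<in> A \<Longrightarrow> u x \<le> u x0"
    and p: "1 \<le> p" and d: "d > 0" "ball x0 d \<subseteq> A"
  shows "u x0 powr (p - 1) \<le> 2 / d\<^sup>2 * exp (12 * p)"
proof -
  define M where "M = u x0"
  define N where "N = 2 * pi"
  have N: "N > 0" by (simp add: N_def)
  have x0: "x0 \<in> A" using d by auto
  have M: "M > 0" using pos x0 by (simp add: M_def)
  define b where "b = ln d"
  have in_A: "log_polar x0 z \<in> A" if "fst z < b" for z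
  proof -
    have "exp (fst z) < exp b" using that by simp
    then have "dist (log_polar x0 z) x0 < d" using d by (simp add: b_def)
    then show ?thesis using d by (auto simp: dist_commute)
  qed
  let ?U = "\<lambda>z. u (log_polar x0 z)"
  \<comment> \<open>\<open>I s\<close> is \<open>N = 2 * pi\<close> times the mean of
    \<open>u\<close> over the circle of radius \<open>exp s\<close> about \<open>x0\<close>.\<close>
  define I where "I s = integral (cbox 0 N) (\<lambda>t. ?U (s, t))" for s
  define I1 where "I1 s = integral (cbox 0 N) (\<lambda>t. P1 x0 (s, t))" for s
  define I11 where "I11 s = integral (cbox 0 N) (\<lambda>t. P11 x0 (s, t))" for s
  define J where "J s = integral (cbox 0 N) (\<lambda>t. ?U (s, t) powr p)" for s
  have contP: "continuous_on ({..<b} \<times> cbox 0 N) (P1 x0)" "continuous_on ({..<b} \<times> cbox 0 N) (P11 x0)"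
    by (rule continuous_P; use in_A in auto)+
  have contT: "continuous_on (cbox 0 N) (\<lambda>t. P1 x0 (s, t))" "continuous_on (cbox 0 N) (\<lambda>t. P11 x0 (s, t))"
    "continuous_on (cbox 0 N) (\<lambda>t. ?U (s, t))" if "s < b" for s
  proof -
    have *: "continuous_on (cbox 0 N) (\<lambda>t. (s, t))" by (intro continuous_intros)
    show "continuous_on (cbox 0 N) (\<lambda>t. P1 x0 (s, t))"
      by (rule continuous_on_compose2[OF continuous_P(1)[of "{s} \<times> cbox 0 N"] *]) (use that in_A in auto)
    show "continuous_on (cbox 0 N) (\<lambda>t. P11 x0 (s, t))"
      by (rule continuous_on_compose2[OF continuous_P(2)[of "{s} \<times> cbox 0 N"] *]) (use that in_A in auto)
    show "continuous_on (cbox 0 N) (\<lambda>t. ?U (s, t))"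
      by (rule continuous_on_compose2[OF continuous_P(3)[of "{s} \<times> cbox 0 N"] *]) (use that in_A in auto)
  qed
  have nz: "?U (s, t) \<noteq> 0" if "s < b" for s t
    using pos[OF in_A[of "(s, t)"]] that by simp
  have contp: "continuous_on (cbox 0 N) (\<lambda>t. ?U (s, t) powr p)" if "s < b" for s
    by (intro continuous_on_powr contT that continuous_on_const) (use nz that in blast)
  have DI: "(I has_real_derivative I1 s) (at s)" and DI1: "(I1 has_real_derivative I11 s) (at s)"
    if s: "s < b" for s
  proof -
    have "(I has_real_derivative I1 s) (at s within {..<b})"
      unfolding I_def[abs_def] I1_def
    proof (rule leibniz_rule_field_derivative)
      show "continuous_on ({..<b} \<times> cbox 0 N) (\<lambda>(s, t). P1 x0 (s, t))" using contP by simp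
    qed (use s in \<open>auto intro!: has_field_derivative_at_within u_log_polar_derivs in_A
        integrable_continuous[OF contT(3), unfolded cbox_interval]\<close>)
    then show "(I has_real_derivative I1 s) (at s)" using s by (simp add: at_within_open[of s "{..<b}"])
    have "(I1 has_real_derivative I11 s) (at s within {..<b})"
      unfolding I1_def[abs_def] I11_def
    proof (rule leibniz_rule_field_derivative)
      show "continuous_on ({..<b} \<times> cbox 0 N) (\<lambda>(s, t). P11 x0 (s, t))" using contP by simp
    qed (use s in \<open>auto intro!: has_field_derivative_at_within u_log_polar_derivs in_A
        integrable_continuous[OF contT(1), unfolded cbox_interval]\<close>)
    then show "(I1 has_real_derivative I11 s) (at s)" using s by (simp add: at_within_open[of s "{..<b}"])
  qed
  \<comment> \<open>The angular second derivative \<open>P22\<close> integrates to zero over a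
    period, since \<open>P2\<close> is periodic; only the radial part of the equation
    remains.\<close>
  have I11: "I11 s = - exp (2 * s) * J s" if s: "s < b" for s
  proof -
    have "((\<lambda>t. P22 x0 (s, t)) has_integral P2 x0 (s, N) - P2 x0 (s, 0)) {0..N}"
      by (rule fundamental_theorem_of_calculus)
         (use N s in \<open>auto intro!: has_field_derivative_at_within u_log_polar_derivs in_A
            simp flip: has_real_derivative_iff_has_vector_derivative\<close>)
    moreover have "P2 x0 (s, N) = P2 x0 (s, 0)"
      by (simp add: P2_def log_polar_def circ_def circ'_def N_def)
    ultimately have 1: "((\<lambda>t. P22 x0 (s, t)) has_integral 0) (cbox 0 N)" by simp
    have "((\<lambda>t. - exp (2 * s) * ?U (s, t) powr p) has_integral - exp (2 * s) * J s) (cbox 0 N)"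
      unfolding J_def using contp[OF s] by (intro has_integral_mult_right integrable_integral integrable_continuous)
    from has_integral_diff[OF this 1]
    have "((\<lambda>t. - exp (2 * s) * ?U (s, t) powr p - P22 x0 (s, t)) has_integral - exp (2 * s) * J s) (cbox 0 N)"
      by simp
    moreover have "- exp (2 * s) * ?U (s, t) powr p - P22 x0 (s, t) = P11 x0 (s, t)" for t
      using log_polar_laplacian[OF in_A, of "(s, t)"] eq[OF in_A, of "(s, t)"] s by simp
    ultimately have "((\<lambda>t. P11 x0 (s, t)) has_integral - exp (2 * s) * J s) (cbox 0 N)" by simp
    then show ?thesis unfolding I11_def by (rule integral_unique)
  qed
  have le_M: "?U (s, t) \<le> M" and gt_0: "?U (s, t) > 0" if "s < b" for s t
    using max pos in_A that by (auto simp: M_def)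
  have const: "integral (cbox 0 N) (\<lambda>t. y) = N * y" for y :: real
    using N by simp
  have I_nonneg: "I s \<ge> 0" and J_nonneg: "J s \<ge> 0" if "s < b" for s
    unfolding I_def J_def
    by (intro integral_nonneg integrable_continuous contT(3) contp that;
        use gt_0[OF that] in \<open>simp add: less_imp_le\<close>)+
  have I_le: "I s \<le> N * M" if "s < b" for s
    using integral_le[OF integrable_continuous[OF contT(3)[OF that]] integrable_const[of M 0 N]] le_M[OF that]
    unfolding I_def const by blast
  have J_le: "J s \<le> N * M powr p" if "s < b" for s
    using integral_le[OF integrable_continuous[OF contp[OF that]] integrable_const[of "M powr p" 0 N]]
      powr_mono2[OF order_trans[OF zero_le_one p] less_imp_le[OF gt_0[OF that]] le_M[OF that]]
    unfolding J_def const by blast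
  \<comment> \<open>Bernoulli's inequality bounds \<open>u powr p\<close> from below by its tangent
    at \<open>M\<close>, and this is integrated over the circle.\<close>
  have J_ge: "J s \<ge> N * M powr p - p * M powr (p - 1) * (N * M - I s)" if s: "s < b" for s
  proof -
    let ?k = "p * M powr (p - 1)"
    have "integral (cbox 0 N) (\<lambda>t. (M powr p - ?k * M) + ?k * ?U (s, t)) \<le> J s"
      unfolding J_def
    proof (rule integral_le)
      show "(\<lambda>t. (M powr p - ?k * M) + ?k * ?U (s, t)) integrable_on cbox 0 N"
        using contT(3)[OF s] by (intro integrable_continuous continuous_intros)
      show "(\<lambda>t. ?U (s, t) powr p) integrable_on cbox 0 N"
        using contp[OF s] by (rule integrable_continuous)
      show "(M powr p - ?k * M) + ?k * ?U (s, t) \<le> ?U (s, t) powr p" for t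
        using powr_diff_le[OF gt_0[OF s] le_M[OF s] order_refl p, of t] by (simp add: algebra_simps)
    qed
    also have "integral (cbox 0 N) (\<lambda>t. (M powr p - ?k * M) + ?k * ?U (s, t)) = N * (M powr p - ?k * M) + ?k * I s"
    proof -
      have "((\<lambda>t. (M powr p - ?k * M) + ?k * ?U (s, t)) has_integral N * (M powr p - ?k * M) + ?k * I s) (cbox 0 N)"
        unfolding I_def const[symmetric]
        by (intro has_integral_add has_integral_mult_right integrable_integral integrable_continuous
              contT(3) s integrable_const)
      then show ?thesis by (rule integral_unique)
    qed
    finally show ?thesis by (simp add: algebra_simps)
  qed
  have lim: "(I \<longlongrightarrow> N * M) at_bot"
  proof (rule order_tendstoI)
    fix y assume "y > N * M"
    then show "\<forall>\<^sub>F s in at_bot. I s < y"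
      using eventually_mono[OF eventually_gt_at_bot[of b], of "\<lambda>s. I s < y"] I_le by force
  next
    fix y assume y: "y < N * M"
    define e where "e = (N * M - y) / (2 * N)"
    have e: "e > 0" "N * (M - e) > y" using y N by (auto simp: e_def field_simps)
    have "isCont u x0" using continuous_u x0 open_A by (simp add: continuous_on_eq_continuous_at)
    then obtain r where r: "r > 0" "\<And>x. dist x x0 < r \<Longrightarrow> dist (u x) M < e"
      using e unfolding M_def continuous_at_eps_delta by blast
    have "I s > y" if s: "s < b" "s < ln r" for s
    proof -
      have "exp s < exp (ln r)" using s by simp
      then have "exp s < r" using r by simp
      then have "M - e \<le> ?U (s, t)" for t
        using r(2)[of "log_polar x0 (s, t)"] by (simp add: dist_real_def)
      then have "integral (cbox 0 N) (\<lambda>t. M - e) \<le> I s"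
        unfolding I_def by (intro integral_le integrable_continuous contT(3) s integrable_const) auto
      then show ?thesis using e by (simp only: const)
    qed
    then show "\<forall>\<^sub>F s in at_bot. y < I s"
      using eventually_conj[OF eventually_gt_at_bot[of b] eventually_gt_at_bot[of "ln r"]]
      by (rule eventually_mono[rotated]) auto
  qed
  have exp_lim: "((\<lambda>s. exp (2 * s)) \<longlongrightarrow> (0::real)) at_bot"
    by (rule filterlim_compose[OF exp_at_bot])
       (auto intro!: filterlim_tendsto_pos_mult_at_bot filterlim_ident tendsto_const)
  define Q where "Q = M powr p"
  have Q: "Q > 0" using M by (simp add: Q_def)
  have MQ: "M powr (p - 1) = Q / M" using M by (simp add: Q_def powr_diff)
  \<comment> \<open>From \<open>J <= N * Q\<close> it follows that
    \<open>I'' >= - N * Q * exp (2 * s)\<close>. The added term has exactly the opposite second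
    derivative, so the sum is convex with limit \<open>N * M\<close>.\<close>
  have I_ge: "I s \<ge> N * M - N * Q / 4 * exp (2 * s)" if s: "s < b" for s
  proof -
    have "N * M + N * Q / 4 * 0 \<le> I s + N * Q / 4 * exp (2 * s)"
    proof (rule convex_bounded_at_bot(2)[of b "\<lambda>s. I s + N * Q / 4 * exp (2 * s)"
          "\<lambda>s. I1 s + N * Q / 2 * exp (2 * s)" "\<lambda>s. I11 s + N * Q * exp (2 * s)"])
      fix s assume s: "s < b"
      show "((\<lambda>s. I s + N * Q / 4 * exp (2 * s)) has_real_derivative I1 s + N * Q / 2 * exp (2 * s)) (at s)"
        by (auto intro!: derivative_eq_intros DI s)
      show "((\<lambda>s. I1 s + N * Q / 2 * exp (2 * s)) has_real_derivative I11 s + N * Q * exp (2 * s)) (at s)"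
        by (auto intro!: derivative_eq_intros DI1 s)
      have "exp (2 * s) * J s \<le> exp (2 * s) * (N * Q)" using J_le[OF s] by (simp add: Q_def)
      then show "I11 s + N * Q * exp (2 * s) \<ge> 0" using I11[OF s] by (simp add: mult_ac)
    next
      show "((\<lambda>s. I s + N * Q / 4 * exp (2 * s)) \<longlongrightarrow> N * M + N * Q / 4 * 0) at_bot"
        by (intro tendsto_intros lim exp_lim)
    qed (use s in auto)
    then show ?thesis by simp
  qed
  \<comment> \<open>This is the squared radius at which the deficit
    \<open>p * (Q / M) * (N * Q / 4 * E)\<close> equals \<open>N * Q / 2\<close>, so that
    \<open>J\<close> keeps at least half of its maximal size for \<open>s < L\<close>.\<close>
  define E where "E = 2 * M / (p * Q)"
  have E: "E > 0" using M Q p by (simp add: E_def)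
  define L where "L = ln E / 2"
  have expL: "exp (2 * L) = E" using E by (simp add: L_def)
  have main: "d\<^sup>2 \<le> E * exp (12 * p)"
  proof (cases "b \<le> L")
    case True
    have "d\<^sup>2 = exp (2 * b)" using d by (simp add: b_def exp_double)
    also have "\<dots> \<le> exp (2 * L)" using True by simp
    also have "\<dots> = E * 1" using expL by simp
    also have "\<dots> \<le> E * exp (12 * p)" using E p by (intro mult_left_mono) auto
    finally show ?thesis .
  next
    case False
    then have Lb: "L < b" by simp
    have J2: "J s \<ge> N * Q / 2" if s: "s < L" for s
    proof -
      have sb: "s < b" using s Lb by simp
      have "exp (2 * s) \<le> E" using s expL by (metis exp_le_cancel_iff less_imp_le mult_le_cancel_left_pos zero_less_numeral)
      then have "N * Q / 4 * exp (2 * s) \<le> N * Q / 4 * E" using N Q by (intro mult_left_mono) auto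
      then have "N * M - I s \<le> N * Q / 4 * E" using I_ge[OF sb] by linarith
      then have "p * (Q / M) * (N * M - I s) \<le> p * (Q / M) * (N * Q / 4 * E)"
        using p Q M by (intro mult_left_mono) auto
      also have "\<dots> = N * Q / 2" using p Q M by (simp add: E_def)
      finally show ?thesis using J_ge[OF sb] by (simp add: MQ Q_def[symmetric])
    qed
    \<comment> \<open>A point strictly inside the range \<open>s < L\<close>; there
      \<open>exp (2 * s0)\<close> is \<open>E\<close> divided by \<open>exp 1\<close>.\<close>
    define s0 where "s0 = L - 1 / 2"
    have s0: "s0 < L" by (simp add: s0_def)
    \<comment> \<open>Now \<open>J >= N * Q / 2\<close> makes
      \<open>- I - N * Q / 8 * exp (2 * s)\<close> convex with a finite limit, so its slope is
      nonnegative; this bounds \<open>I1\<close> from above.\<close>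
    have "- I1 s0 - N * Q / 4 * exp (2 * s0) \<ge> 0"
    proof (rule convex_bounded_at_bot(1)[of L "\<lambda>s. - I s - N * Q / 8 * exp (2 * s)" 
          "\<lambda>s. - I1 s - N * Q / 4 * exp (2 * s)" "\<lambda>s. - I11 s - N * Q / 2 * exp (2 * s)"
          "- (N * M) - N * Q / 8 * 0"])
      fix s assume s: "s < L"
      then have sb: "s < b" using Lb by simp
      show "((\<lambda>s. - I s - N * Q / 8 * exp (2 * s)) has_real_derivative - I1 s - N * Q / 4 * exp (2 * s)) (at s)"
        by (auto intro!: derivative_eq_intros DI sb)
      show "((\<lambda>s. - I1 s - N * Q / 4 * exp (2 * s)) has_real_derivative - I11 s - N * Q / 2 * exp (2 * s)) (at s)"
        by (auto intro!: derivative_eq_intros DI1 sb)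
      have "exp (2 * s) * (N * Q / 2) \<le> exp (2 * s) * J s" using J2[OF s] by (intro mult_left_mono) auto
      then show "- I11 s - N * Q / 2 * exp (2 * s) \<ge> 0" using I11[OF sb] by (simp add: mult_ac)
    next
      show "((\<lambda>s. - I s - N * Q / 8 * exp (2 * s)) \<longlongrightarrow> - (N * M) - N * Q / 8 * 0) at_bot"
        by (intro tendsto_intros lim exp_lim)
    qed (use s0 in auto)
    moreover have "exp (2 * s0) = E / exp 1"
      by (simp add: s0_def right_diff_distrib exp_diff expL)
    moreover have "N * Q / 4 * (E / exp 1) = N * M / (2 * p * exp 1)"
      using p Q by (simp add: E_def mult_ac)
    ultimately have slope: "I1 s0 \<le> - (N * M / (2 * p * exp 1))" by simp
    have decr: "I1 s \<le> I1 s0" if s: "s0 \<le> s" "s < b" for s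
    proof (rule DERIV_nonpos_imp_nonincreasing[OF s(1)])
      fix y assume "s0 \<le> y" "y \<le> s"
      then have yb: "y < b" using s by simp
      have "I11 y \<le> 0" using I11[OF yb] J_nonneg[OF yb] by (simp add: mult_nonneg_nonneg)
      then show "\<exists>D. (I1 has_real_derivative D) (at y) \<and> D \<le> 0" using DI1[OF yb] by blast
    qed
    \<comment> \<open>Beyond \<open>s0\<close> the function \<open>I\<close> decreases at rate at
      least \<open>N * M / (2 * p * exp 1)\<close>. It starts at most at \<open>N * M\<close> and
      stays nonnegative, so this lasts at most for a length
      \<open>2 * p * exp 1 <= 6 * p\<close>.\<close>
    have "s - s0 \<le> 6 * p" if s: "s0 < s" "s < b" for s
    proof -
      have "\<exists>z. s0 < z \<and> z < s \<and> I s - I s0 = (s - s0) * I1 z"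
        by (rule MVT2) (use s DI in auto)
      then obtain z where z: "s0 < z" "z < s" "I s - I s0 = (s - s0) * I1 z" by auto
      have "I1 z \<le> - (N * M / (2 * p * exp 1))" using decr[of z] z s slope by simp
      then have "(s - s0) * I1 z \<le> (s - s0) * - (N * M / (2 * p * exp 1))"
        using s by (intro mult_left_mono) auto
      then have "(s - s0) * (N * M / (2 * p * exp 1)) \<le> N * M"
        using z I_nonneg[OF s(2)] I_le[of s0] s by simp
      then have "(N * M) * (s - s0) \<le> (N * M) * (2 * p * exp 1)"
        using p by (simp add: field_simps)
      then have "s - s0 \<le> 2 * p * exp 1" using N M by simp
      also have "\<dots> \<le> 2 * p * 3" using p exp_le by (intro mult_left_mono) auto
      finally show ?thesis by simp
    qed
    then have "b \<le> s0 + 6 * p"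
      using s0 Lb by (intro dense_le_bounded[of s0 b]) force+
    then have "2 * b \<le> 2 * L + 12 * p" by (simp add: s0_def)
    then have "exp (2 * b) \<le> exp (2 * L + 12 * p)" by simp
    moreover have "exp (2 * b) = d\<^sup>2" using d by (simp add: b_def exp_double)
    ultimately show ?thesis by (simp add: exp_add expL)
  qed
  have "d\<^sup>2 * (p * Q) \<le> 2 * M * exp (12 * p)"
    using main p Q by (simp add: E_def field_simps)
  moreover have "d\<^sup>2 * Q \<le> d\<^sup>2 * (p * Q)" using p Q by (intro mult_left_mono) auto
  ultimately have "Q / M \<le> 2 / d\<^sup>2 * exp (12 * p)"
    using d M by (simp add: field_simps)
  then show ?thesis using MQ by (simp add: M_def)
qed

end

section \<open>Exterior circles\<close>

lemma orthogonal_coordinates: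
  fixes T :: "real ^ 2 \<Rightarrow> real ^ 2"
  assumes "orthogonal_transformation T"
  shows "x \<bullet> y = T x $ 1 * T y $ 1 + T x $ 2 * T y $ 2"
proof -
  have "x \<bullet> y = T x \<bullet> T y" using assms by (simp add: orthogonal_transformation_def)
  then show ?thesis by (simp add: inner_vec_def sum_2)
qed

lemma blinfun_real_apply: "blinfun_apply F v = F 1 * v" for F :: "real \<Rightarrow>\<^sub>L real"
  using blinfun.scaleR_right[of F v 1] by simp

text \<open>The slope \<open>s\<close> is the derivative of \<open>g\<close> at \<open>a\<close>. On
  the interval of radius \<open>e\<close> around \<open>a\<close> the derivative deviates from it by
  at most \<open>K * e\<close>, so \<open>g\<close> minus its tangent is Lipschitz with that
  constant. Leaving \<open>e\<close> free gives both a quadratic bound and a small Lipschitz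
  constant.\<close>

lemma tangent_line_estimate:
  fixes g :: "real \<Rightarrow> real"
  assumes "C2_on UNIV g"
  obtains s K d where "K > 0" "d > 0"
    "\<And>e x y. e < d \<Longrightarrow> \<bar>x - a\<bar> \<le> e \<Longrightarrow> \<bar>y - a\<bar> \<le> e \<Longrightarrow> \<bar>g x - g y - s * (x - y)\<bar> \<le> K * e * \<bar>x - y\<bar>"
proof -
  obtain f' :: "real \<Rightarrow> real \<Rightarrow>\<^sub>L real" and f'' :: "real \<Rightarrow> real \<Rightarrow>\<^sub>L (real \<Rightarrow>\<^sub>L real)"
    where f: "\<And>x. (g has_derivative f' x) (at x)" "\<And>x. (f' has_derivative f'' x) (at x)"
    using assms unfolding C2_on_def by auto
  define h where "h x = f' x 1" for x
  have g: "(g has_real_derivative h x) (at x)" for x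
    using f(1)[of x] unfolding has_field_derivative_def h_def
    by (rule has_derivative_eq_rhs) (rule ext, rule blinfun_real_apply)
  have "(h has_derivative (\<lambda>v. f'' a v 1)) (at a)"
    unfolding h_def[abs_def] using blinfun.FDERIV[OF f(2) has_derivative_const, of 1 a] by simp
  then have "(h has_real_derivative f'' a 1 1) (at a)"
    unfolding has_field_derivative_def
  proof (rule has_derivative_eq_rhs)
    show "(\<lambda>v. f'' a v 1) = (*) (f'' a 1 1)"
    proof
      fix v :: real
      have "f'' a v = v *\<^sub>R f'' a 1" using blinfun.scaleR_right[of "f'' a" v 1] by simp
      then show "f'' a v 1 = f'' a 1 1 * v" by (simp add: blinfun.scaleR_left)
    qed
  qed
  then have "((\<lambda>x. (h x - h a) / (x - a)) \<longlongrightarrow> f'' a 1 1) (at a)"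
    by (simp add: has_field_derivative_iff)
  then have "\<forall>\<^sub>F x in at a. dist ((h x - h a) / (x - a)) (f'' a 1 1) < 1"
    by (rule tendstoD) simp
  then obtain d where d: "d > 0" "\<And>x. x \<noteq> a \<Longrightarrow> dist x a < d \<Longrightarrow> dist ((h x - h a) / (x - a)) (f'' a 1 1) < 1"
    unfolding eventually_at by blast
  define K where "K = \<bar>f'' a 1 1\<bar> + 1"
  have h: "\<bar>h x - h a\<bar> \<le> K * \<bar>x - a\<bar>" if "\<bar>x - a\<bar> < d" for x
  proof (cases "x = a")
    case False
    then have "\<bar>(h x - h a) / (x - a) - f'' a 1 1\<bar> < 1"
      using d(2)[of x] that unfolding dist_real_def by blast
    then have "\<bar>(h x - h a) / (x - a)\<bar> \<le> K" unfolding K_def by linarith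
    then show ?thesis using False by (simp add: abs_divide field_simps)
  qed simp
  show ?thesis
  proof (rule that[of K d])
    fix e x y :: real
    assume e: "e < d" and xy: "\<bar>x - a\<bar> \<le> e" "\<bar>y - a\<bar> \<le> e"
    have "norm ((g x - h a * x) - (g y - h a * y)) \<le> K * e * norm (x - y)"
    proof (rule field_differentiable_bound[of "cball a e"])
      show "((\<lambda>x. g x - h a * x) has_field_derivative h z - h a) (at z within cball a e)" for z
        by (auto intro!: derivative_eq_intros has_field_derivative_at_within[OF g])
      show "norm (h z - h a) \<le> K * e" if "z \<in> cball a e" for z
      proof -
        have z: "\<bar>z - a\<bar> \<le> e" using that by (simp add: dist_real_def abs_minus_commute)
        then have "\<bar>h z - h a\<bar> \<le> K * \<bar>z - a\<bar>" using h e by simp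
        also have "\<dots> \<le> K * e" using z by (intro mult_left_mono) (auto simp: K_def)
        finally show ?thesis by simp
      qed
    qed (use xy in \<open>auto simp: dist_real_def abs_minus_commute\<close>)
    then show "\<bar>g x - g y - h a * (x - y)\<bar> \<le> K * e * \<bar>x - y\<bar>" by (simp add: algebra_simps)
  qed (use d in \<open>auto simp: K_def\<close>)
qed

text \<open>The centre lies at distance \<open>r\<close> from \<open>x0\<close> along the outer
  normal. For small \<open>r\<close> the circle curves more sharply than the boundary, so it stays
  outside; near \<open>x0\<close> the rays from \<open>c\<close> are almost normal to the graph, so
  they enter the domain and remain there for a short while.\<close>

lemma exterior_circle:
  assumes "open S" "C2_boundary S" "x0 \<in> frontier S"
  obtains c r R where "0 < r" "r < R" "dist x0 c < R"
    "\<And>x. x \<in> closure S \<Longrightarrow> r \<le> dist x c"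
    "\<And>x k. x \<in> closure S \<Longrightarrow> dist x c \<le> R \<Longrightarrow> 1 < k \<Longrightarrow> k \<le> (R / r)\<^sup>2 \<Longrightarrow> c + k *\<^sub>R (x - c) \<in> S"
proof -
  obtain r0 and T :: "real ^ 2 \<Rightarrow> real ^ 2" and g :: "real \<Rightarrow> real" where r0: "r0 > 0" and T: "orthogonal_transformation T" and g: "C2_on UNIV g"
    and S: "S \<inter> ball x0 r0 = {x \<in> ball x0 r0. g (T x $ 1) < T x $ 2}"
    using assms unfolding C2_boundary_def by blast
  define a where "a = T x0 $ 1"
  obtain s K d where K: "K > 0" and d: "d > 0"
    and est: "\<And>e x y. e < d \<Longrightarrow> \<bar>x - a\<bar> \<le> e \<Longrightarrow> \<bar>y - a\<bar> \<le> e \<Longrightarrow>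
                \<bar>g x - g y - s * (x - y)\<bar> \<le> K * e * \<bar>x - y\<bar>"
    by (rule tangent_line_estimate[OF g, of a]) (rule that)
  have linT: "linear T" using T by (rule orthogonal_transformation_linear)
  have normT: "norm (T x) = norm x" for x using T by (simp add: orthogonal_transformation_norm)
  have contT: "continuous_on A T" for A
    using linT by (simp add: linear_continuous_on linear_conv_bounded_linear)
  have Tdiff: "T (x - y) $ i = T x $ i - T y $ i" for x y i
    using linT by (simp add: linear_diff)
  have Tle: "\<bar>T x $ i\<bar> \<le> norm x" for x i
    using component_le_norm_cart[of "T x" i] normT by simp
  have contg: "continuous_on A g" for A
    using g unfolding C2_on_def
    by (meson UNIV_I continuous_at_imp_continuous_on has_derivative_continuous)
  have closure: "g (T x $ 1) \<le> T x $ 2" if "x \<in> closure S" "dist x x0 < r0" for x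
  proof -
    have "x \<in> ball x0 r0 \<inter> closure S" using that by (simp add: dist_commute)
    then have "x \<in> closure (ball x0 r0 \<inter> S)" using open_Int_closure_subset[OF open_ball] by blast
    also have "\<dots> \<subseteq> {x. g (T x $ 1) \<le> T x $ 2}"
    proof (rule closure_minimal)
      show "ball x0 r0 \<inter> S \<subseteq> {x. g (T x $ 1) \<le> T x $ 2}"
        unfolding Int_commute[of _ S] S by (auto simp: less_imp_le)
      show "closed {x. g (T x $ 1) \<le> T x $ 2}"
        by (intro closed_Collect_le continuous_on_compose2[OF contg[of UNIV]] continuous_on_component contT) auto
    qed
    finally show ?thesis by simp
  qed
  have g0: "g a = T x0 $ 2"
  proof -
    have "x0 \<in> closure S" "x0 \<notin> S" using assms by (auto simp: frontier_def interior_open)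
    then show ?thesis using closure[of x0] S r0 by (force simp: a_def)
  qed
  define q where "q = sqrt (1 + s\<^sup>2)"
  have q: "q \<ge> 1" "q\<^sup>2 = 1 + s\<^sup>2" by (auto simp: q_def)
  \<comment> \<open>In the coordinates of \<open>T\<close> this is the unit normal to the tangent
    line, pointing to the side above the graph.\<close>
  obtain n where n: "T n = vector [- s / q, 1 / q]"
    using orthogonal_transformation_surj[OF T] by (metis surjD)
  have "n \<bullet> n = (1 + s\<^sup>2) / q\<^sup>2"
    unfolding orthogonal_coordinates[OF T] n by (simp add: power2_eq_square add_divide_distrib)
  also have "\<dots> = 1" unfolding q(2)[symmetric] using q(1) by simp
  finally have n1: "norm n = 1" by (simp add: norm_eq_1)
  have inner_n: "q * (x \<bullet> n) = T x $ 2 - s * T x $ 1" for x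
    using q unfolding orthogonal_coordinates[OF T] n by (simp add: field_simps)
  \<comment> \<open>The bound \<open>1 / (4 * K)\<close> makes \<open>g\<close> minus its tangent
    Lipschitz with constant at most \<open>1 / 4\<close> on the interval of radius
    \<open>r2\<close>.\<close>
  define m where "m = min (min r0 d) (1 / (4 * K))"
  have m: "m > 0" "m \<le> r0" "m \<le> d" "m \<le> 1 / (4 * K)" using r0 d K by (auto simp: m_def)
  define r2 where "r2 = m / 2"
  have r2: "0 < r2" "r2 < r0" "r2 < d" "r2 < 1 / (4 * K)" using m unfolding r2_def by linarith+
  then have Kr2: "K * r2 \<le> 1 / 4" using K by (simp add: field_simps)
  define r where "r = r2 / 8"
  \<comment> \<open>The ratio \<open>25 / 24\<close> keeps the points of \<open>closure S\<close> in \<open>cball c R\<close> within \<open>r / 2\<close> of \<open>x0\<close>, where the rays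
    from \<open>c\<close> are still transversal to the graph.\<close>
  define R where "R = r * 25 / 24"
  have r: "r > 0" "r < R" "8 * r = r2" "K * r \<le> 1 / 32" using r2 Kr2 by (auto simp: r_def R_def)
  define c where "c = x0 - r *\<^sub>R n"
  have dx0: "dist x0 c = r" using n1 r by (simp add: c_def dist_norm)
  \<comment> \<open>The normal component of \<open>x - x0\<close> is at least \<open>- K\<close>
    times the squared distance. Expanding the squared distance to \<open>c\<close> multiplies it by
    \<open>2 * r\<close>, and \<open>K * r <= 1 / 32\<close> lets the quadratic term
    dominate.\<close>
  have below: "(dist x c)\<^sup>2 \<ge> r\<^sup>2 + (dist x x0)\<^sup>2 / 2" if x: "x \<in> closure S" "dist x x0 < r2" for x
  proof -
    let ?D = "dist x x0"
    have X: "\<bar>T x $ 1 - a\<bar> \<le> ?D" using Tle[of "x - x0" 1] by (simp add: a_def Tdiff dist_norm)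
    have "\<bar>g (T x $ 1) - g a - s * (T x $ 1 - a)\<bar> \<le> K * ?D * \<bar>T x $ 1 - a\<bar>"
      using x r2 X by (intro est) auto
    also have "\<dots> \<le> K * ?D * ?D" using X K by (intro mult_left_mono) auto
    finally have "g (T x $ 1) - g a - s * (T x $ 1 - a) \<ge> - (K * ?D * ?D)" by linarith
    moreover have "q * ((x - x0) \<bullet> n) = T x $ 2 - g a - s * (T x $ 1 - a)"
      using g0 by (simp add: inner_n Tdiff a_def)
    ultimately have "q * ((x - x0) \<bullet> n) \<ge> - (K * ?D * ?D)"
      using closure[of x] x r2 by simp
    then have "(x - x0) \<bullet> n \<ge> - (K * ?D * ?D)"
    proof (cases "(x - x0) \<bullet> n \<ge> 0")
      case True
      moreover have "K * ?D * ?D \<ge> 0" using K by simp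
      ultimately show ?thesis by linarith
    next
      case False
      then have "q * ((x - x0) \<bullet> n) \<le> 1 * ((x - x0) \<bullet> n)"
        using q by (intro mult_right_mono_neg) auto
      then show ?thesis using \<open>q * ((x - x0) \<bullet> n) \<ge> - (K * ?D * ?D)\<close> by simp
    qed
    then have "2 * r * - (K * ?D * ?D) \<le> 2 * r * ((x - x0) \<bullet> n)"
      using r by (intro mult_left_mono) auto
    then have "- (2 * r * (K * ?D * ?D)) \<le> 2 * r * ((x - x0) \<bullet> n)" by (simp only: mult_minus_right)
    moreover have "2 * r * (K * ?D * ?D) \<le> ?D\<^sup>2 / 2"
    proof -
      have "(K * r) * (2 * ?D\<^sup>2) \<le> 1 / 32 * (2 * ?D\<^sup>2)" using r by (intro mult_right_mono) auto
      moreover have "2 * r * (K * ?D * ?D) = (K * r) * (2 * ?D\<^sup>2)" by (simp add: power2_eq_square)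
      ultimately show ?thesis using zero_le_power2[of ?D] by linarith
    qed
    moreover have "(dist x c)\<^sup>2 = ?D\<^sup>2 + 2 * r * ((x - x0) \<bullet> n) + r\<^sup>2"
    proof -
      have "(norm ((x - x0) + r *\<^sub>R n))\<^sup>2 = (norm (x - x0))\<^sup>2 + 2 * ((x - x0) \<bullet> (r *\<^sub>R n)) + (norm (r *\<^sub>R n))\<^sup>2"
        unfolding power2_norm_eq_inner by (simp add: inner_add_left inner_add_right inner_commute)
      then show ?thesis using n1 by (simp add: dist_norm c_def algebra_simps)
    qed
    ultimately show ?thesis by linarith
  qed
  \<comment> \<open>Points of the closed disc of radius \<open>R\<close> about \<open>c\<close> lie
    where the graph description holds; hence the local estimate suffices for all of
    \<open>closure S\<close>.\<close>
  have near: "dist x x0 < r2" if "dist x c \<le> R" for x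
  proof -
    have "dist x x0 \<le> dist x c + dist x0 c" using dist_triangle2[of x x0 c] .
    then show ?thesis using that dx0 r unfolding R_def by linarith
  qed
  show ?thesis
  proof (rule that[OF r(1,2)])
    show "dist x0 c < R" using dx0 r by simp
    show "r \<le> dist x c" if x: "x \<in> closure S" for x
    proof (rule ccontr)
      assume "\<not> r \<le> dist x c"
      then have "dist x c < r" by simp
      then have "r\<^sup>2 + (dist x x0)\<^sup>2 / 2 \<le> (dist x c)\<^sup>2" using below x near r by simp
      moreover have "(dist x c)\<^sup>2 < r\<^sup>2" using \<open>dist x c < r\<close> by (intro power_strict_mono) auto
      ultimately show False by (smt (verit) zero_le_power2 divide_nonneg_pos)
    qed
    fix x k assume x: "x \<in> closure S" "dist x c \<le> R" and k: "1 < k" "k \<le> (R / r)\<^sup>2"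
    have "(R / r)\<^sup>2 = (25 / 24)\<^sup>2" using r by (simp add: R_def)
    then have "k \<le> (25 / 24)\<^sup>2" using k by metis
    then have k': "k - 1 < 1 / 8" by (simp add: power2_eq_square)
    define D where "D = dist x x0"
    have "D\<^sup>2 / 2 \<le> R\<^sup>2 - r\<^sup>2"
      using below[OF x(1) near[OF x(2)]] power_mono[OF x(2) zero_le_dist, of 2] by (simp add: D_def)
    also have "R\<^sup>2 - r\<^sup>2 = r\<^sup>2 * (49 / 576)" by (simp add: R_def power2_eq_square)
    also have "\<dots> \<le> (r / 2)\<^sup>2 / 2" by (simp add: power2_eq_square)
    finally have "D\<^sup>2 \<le> (r / 2)\<^sup>2" by simp
    then have D: "D \<le> r / 2" using r by (intro power2_le_imp_le[of D "r / 2"]) auto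
    define z where "z = x - c"
    have z: "norm z \<le> R" using x by (simp add: z_def dist_norm)
    define y where "y = c + k *\<^sub>R (x - c)"
    have y: "y - x = (k - 1) *\<^sub>R z" by (simp add: y_def z_def algebra_simps)
    have "dist y x = (k - 1) * norm z" using k by (simp add: dist_norm y)
    also have "\<dots> \<le> 1 / 8 * R" using k' z k by (intro mult_mono) auto
    finally have yx: "dist y x \<le> r" using r by (simp add: R_def)
    have "dist y x0 \<le> dist y x + D" unfolding D_def by (rule dist_triangle)
    then have yx0: "dist y x0 < r2" using yx D r by linarith
    have xx0: "dist x x0 < r2" using D r by (simp add: D_def)
    have X: "\<bar>T v $ 1 - a\<bar> \<le> r2" if "dist v x0 < r2" for v
      using Tle[of "v - x0" 1] that by (simp add: a_def Tdiff dist_norm)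
    have Ty: "T y $ i = T x $ i + (k - 1) * T z $ i" for i
      using arg_cong[OF y, of "\<lambda>v. T v $ i"] linT by (simp add: Tdiff linear_cmul)
    have "\<bar>g (T y $ 1) - g (T x $ 1) - s * (T y $ 1 - T x $ 1)\<bar> \<le> K * r2 * \<bar>T y $ 1 - T x $ 1\<bar>"
      by (intro est r2 X yx0 xx0)
    also have "\<dots> \<le> 1 / 4 * \<bar>T y $ 1 - T x $ 1\<bar>" using Kr2 by (intro mult_right_mono) auto
    also have "\<dots> = (k - 1) * (1 / 4 * \<bar>T z $ 1\<bar>)" using k by (simp add: Ty abs_mult)
    also have "\<dots> \<le> (k - 1) * (1 / 4 * R)" using k z Tle[of z 1] by (intro mult_left_mono) auto
    finally have "g (T y $ 1) - g (T x $ 1) - s * (T y $ 1 - T x $ 1) \<le> (k - 1) * (1 / 4 * R)"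
      by (rule order_trans[OF abs_ge_self])
    moreover have "s * (T y $ 1 - T x $ 1) = (k - 1) * (s * T z $ 1)" by (simp add: Ty)
    moreover have "(k - 1) * (s * T z $ 1 + R / 4) = (k - 1) * (s * T z $ 1) + (k - 1) * (1 / 4 * R)"
      by (simp add: distrib_left)
    ultimately have gy: "g (T y $ 1) \<le> g (T x $ 1) + (k - 1) * (s * T z $ 1 + R / 4)" by linarith
    \<comment> \<open>Transversality: the normal component of \<open>z = x - c\<close> is at least
      \<open>r - D >= r / 2\<close>, which beats the error \<open>R / 4\<close> of the tangent
      approximation.\<close>
    have "T z $ 2 - s * T z $ 1 = q * (z \<bullet> n)" by (simp add: inner_n)
    also have "z \<bullet> n = (x - x0) \<bullet> n + r"
      using n1 by (simp add: z_def c_def inner_diff_left inner_add_left norm_eq_1)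
    also have "\<bar>(x - x0) \<bullet> n\<bar> \<le> D"
      using Cauchy_Schwarz_ineq2[of "x - x0" n] n1 by (simp add: D_def dist_norm)
    then have "1 * (r / 2) \<le> q * ((x - x0) \<bullet> n + r)"
      using q D r by (intro mult_mono) auto
    finally have "r / 2 \<le> T z $ 2 - s * T z $ 1" by simp
    then have "R / 4 < T z $ 2 - s * T z $ 1" using r unfolding R_def by linarith
    then have "(k - 1) * (R / 4) < (k - 1) * (T z $ 2 - s * T z $ 1)"
      using k by (intro mult_strict_left_mono) auto
    then have "g (T y $ 1) < g (T x $ 1) + (k - 1) * T z $ 2"
      using gy by (simp add: algebra_simps)
    also have "\<dots> \<le> T y $ 2" using closure[of x] x xx0 r2 by (simp add: Ty)
    finally have "g (T y $ 1) < T y $ 2" .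
    then have "y \<in> {x \<in> ball x0 r0. g (T x $ 1) < T x $ 2}"
      using yx0 r2 by (simp add: dist_commute)
    then show "c + k *\<^sub>R (x - c) \<in> S" using S unfolding y_def by blast
  qed
qed

section \<open>The a priori bound\<close>

text \<open>After the root of order \<open>p - 1\<close> the exponents are
  \<open>1 / (p - 1)\<close> and \<open>12 + 12 / (p - 1)\<close>. Both decrease in
  \<open>p\<close>, and with \<open>k >= 1\<close> the value at \<open>p0\<close> is the
  largest.\<close>

lemma powr_bound_uniform:
  fixes M k p p0 :: real
  assumes "p0 > 1" "p \<ge> p0" "k \<ge> 1" "M \<ge> 0" and le: "M powr (p - 1) \<le> k * exp (12 * p)"
  shows "M \<le> k powr (1 / (p0 - 1)) * exp (12 + 12 / (p0 - 1))"
proof -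
  have p: "p > 1" using assms by simp
  have inv: "1 / (p - 1) \<le> 1 / (p0 - 1)" using assms by (intro divide_left_mono) auto
  have "M = (M powr (p - 1)) powr (1 / (p - 1))" using assms p by (simp add: powr_powr)
  also have "\<dots> \<le> (k * exp (12 * p)) powr (1 / (p - 1))"
    using le p by (intro powr_mono2) auto
  also have "\<dots> = k powr (1 / (p - 1)) * exp (12 * p / (p - 1))"
    using assms by (simp add: powr_mult exp_powr_real)
  also have "12 * p / (p - 1) = 12 + 12 * (1 / (p - 1))" using p by (simp add: field_simps)
  also have "k powr (1 / (p - 1)) * exp (12 + 12 * (1 / (p - 1)))
      \<le> k powr (1 / (p0 - 1)) * exp (12 + 12 * (1 / (p0 - 1)))"
    using inv assms by (intro mult_mono powr_mono) auto
  finally show ?thesis by simp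
qed

lemma Linf_norm_le:
  assumes "open S" "continuous_on S u" "\<And>x. x \<in> S \<Longrightarrow> \<bar>u x\<bar> \<le> M"
  shows "Linf_norm S u \<le> ereal M"
  unfolding Linf_norm_def
proof (rule esssup_I)
  have "u \<in> borel_measurable (lebesgue_on S)"
    using assms by (intro continuous_imp_measurable_on_sets_lebesgue) auto
  then show "(\<lambda>x. ereal \<bar>u x\<bar>) \<in> borel_measurable (lebesgue_on S)" by measurable
  show "AE x in lebesgue_on S. ereal \<bar>u x\<bar> \<le> ereal M"
    using assms by (intro AE_I2) auto
qed

theorem theorem1p1:
  fixes \<Omega> :: "(real ^ 2) set" and p0 :: real
  assumes "is_domain \<Omega>" and "bounded \<Omega>" and "C2_boundary \<Omega>" and "p0 > 1"
  shows "\<exists>C::real. \<forall>p\<ge>p0. \<forall>u :: real ^ 2 \<Rightarrow> real.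
           C2_on \<Omega> u \<and> continuous_on (closure \<Omega>) u \<and>
           (\<forall>x\<in>\<Omega>. laplacian u x + u x powr p = 0) \<and>
           (\<forall>x\<in>\<Omega>. u x > 0) \<and>
           (\<forall>x\<in>frontier \<Omega>. u x = 0)
           \<longrightarrow> Linf_norm \<Omega> u \<le> ereal C"
proof -
  have \<Omega>: "open \<Omega>" "\<Omega> \<noteq> {}" using assms(1) by (auto simp: is_domain_def)
  have closure_eq: "closure \<Omega> = \<Omega> \<union> frontier \<Omega>" using \<Omega> by (simp add: frontier_def interior_open closure_subset Un_absorb1)
  \<comment> \<open>These are the data that \<open>exterior_circle\<close> supplies and
    \<open>reflection_in_circle\<close> consumes; they involve neither \<open>p\<close> nor
    \<open>u\<close>.\<close>
  define good where "good c r R \<longleftrightarrow> 0 < r \<and> r < R \<and> (\<forall>x\<in>closure \<Omega>. r \<le> dist x c) \<and>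
      (\<forall>x\<in>closure \<Omega>. \<forall>k. dist x c \<le> R \<longrightarrow> 1 < k \<longrightarrow> k \<le> (R / r)\<^sup>2 \<longrightarrow> c + k *\<^sub>R (x - c) \<in> \<Omega>)"
    for c :: "real ^ 2" and r R :: real
  define \<B> where "\<B> = {ball c R | c r R. good c r R}"
  have "frontier \<Omega> \<subseteq> \<Union>\<B>"
  proof
    fix x assume "x \<in> frontier \<Omega>"
    from exterior_circle[OF \<Omega>(1) assms(3) this]
    obtain c r R where "good c r R" "dist x c < R" unfolding good_def by metis
    then have "ball c R \<in> \<B>" "x \<in> ball c R" by (auto simp: \<B>_def dist_commute)
    then show "x \<in> \<Union>\<B>" by blast
  qed
  moreover have "open G" if "G \<in> \<B>" for G using that by (auto simp: \<B>_def)
  \<comment> \<open>\<open>d\<close> is a Lebesgue number of the cover of the compact boundary by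
    these discs, so it depends only on the domain.\<close>
  ultimately obtain d where d: "d > 0" "\<And>x. x \<in> frontier \<Omega> \<Longrightarrow> \<exists>G\<in>\<B>. ball x d \<subseteq> G"
    using Heine_Borel_lemma[OF compact_frontier_bounded[OF assms(2)]] by blast
  define k where "k = max 1 (2 / d\<^sup>2)"
  show ?thesis
  proof (intro exI[of _ "k powr (1 / (p0 - 1)) * exp (12 + 12 / (p0 - 1))"] allI impI, elim conjE)
    fix p and u :: "real ^ 2 \<Rightarrow> real"
    assume p: "p0 \<le> p" and C2: "C2_on \<Omega> u" and cont: "continuous_on (closure \<Omega>) u"
      and eq: "\<forall>x\<in>\<Omega>. laplacian u x + u x powr p = 0"
      and pos: "\<forall>x\<in>\<Omega>. u x > 0" and zero: "\<forall>x\<in>frontier \<Omega>. u x = 0"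
    have p1: "1 \<le> p" using p assms(4) by simp
    have eq': "laplacian u x = - (u x powr p)" if "x \<in> \<Omega>" for x
      using eq that by (simp add: eq_neg_iff_add_eq_0)
    obtain u' u'' where "twice_differentiable \<Omega> u u' u''"
      using C2 \<Omega>(1) unfolding C2_on_def twice_differentiable_def by auto
    then interpret twice_differentiable \<Omega> u u' u'' .
    have "compact (closure \<Omega>)" using assms(2) by simp
    then obtain xm where xm: "xm \<in> closure \<Omega>" "\<And>x. x \<in> closure \<Omega> \<Longrightarrow> u x \<le> u xm"
      using continuous_attains_sup[OF _ _ cont] \<Omega>(2) by auto
    obtain y where "y \<in> \<Omega>" using \<Omega>(2) by blast
    then have "u xm > 0" using pos xm(2)[of y] closure_eq by fastforce
    then have xm\<Omega>: "xm \<in> \<Omega>" using xm zero closure_eq by fastforce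
    have away: "xm \<notin> ball c R" if "good c r R" for c r R
    proof
      assume "xm \<in> ball c R"
      then have "\<exists>y\<in>\<Omega>. u xm < u y"
        using that xm\<Omega> unfolding good_def
        by (intro reflection_in_circle[OF cont _ _ eq' xm(2) p1, of r R c xm])
           (auto simp: dist_commute pos zero)
      then show False using xm(2) closure_eq by force
    qed
    have "ball xm d \<inter> frontier \<Omega> = {}"
    proof (rule ccontr)
      assume "ball xm d \<inter> frontier \<Omega> \<noteq> {}"
      then obtain x where x: "x \<in> frontier \<Omega>" "xm \<in> ball x d" by (auto simp: dist_commute)
      then obtain G where "G \<in> \<B>" "xm \<in> G" using d(2)[OF x(1)] by blast
      then show False using away by (auto simp: \<B>_def)
    qed
    \<comment> \<open>The ball is connected, contains the interior point \<open>xm\<close> and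
      misses the boundary.\<close>
    then have "ball xm d \<subseteq> \<Omega>"
      using connected_Int_frontier[OF connected_ball, of xm d \<Omega>] xm\<Omega> centre_in_ball[of xm d] d(1) by blast
    then have "u xm powr (p - 1) \<le> 2 / d\<^sup>2 * exp (12 * p)"
      using pos xm(2) closure_eq by (intro max_bound eq' p1 d(1)) auto
    also have "\<dots> \<le> k * exp (12 * p)" by (intro mult_right_mono) (auto simp: k_def)
    finally have M: "u xm \<le> k powr (1 / (p0 - 1)) * exp (12 + 12 / (p0 - 1))"
      using \<open>u xm > 0\<close> by (intro powr_bound_uniform[OF assms(4) p]) (auto simp: k_def)
    have "Linf_norm \<Omega> u \<le> ereal (u xm)"
      using pos xm(2) closure_eq by (intro Linf_norm_le \<Omega>(1) continuous_u) (auto simp: less_imp_le)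
    also have "\<dots> \<le> ereal (k powr (1 / (p0 - 1)) * exp (12 + 12 / (p0 - 1)))" using M by simp
    finally show "Linf_norm \<Omega> u \<le> ereal (k powr (1 / (p0 - 1)) * exp (12 + 12 / (p0 - 1)))" .
  qed
qed

end
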